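(* (2-degree modular equation for the first derivative of the Rogers–Ramanujan continued fraction.) Let $q\in(0,1)$ and put $u=N(q)$ and $v=N(q^{2})$. Then $$5u^{6}-u^{2}v^{2}-125u^{4}v^{4}+5v^{6}=0.$$
   Context: Let $f(-q)=\prod_{n=1}^{\infty}(1-q^{n})$. Let $R(q)=q^{1/5}\prod_{n=0}^{\infty}\frac{(1-q^{5n+1})(1-q^{5n+4})}{(1-q^{5n+2})(1-q^{5n+3})}$ be the Rogers–Ramanujan continued fraction, for $0<q<1$. Define $$N(q)=q^{5/6}f(-q)^{-4}\,\frac{R'(q)}{R(q)}=q^{-1/6}f(-q)^{-4}\left(\frac15-\sum_{n=1}^{\infty}q^{n}\sum_{d\mid n}X(d)\,d\right),$$ where $R'=dR/dq$ and $X(d)=\left(\frac{d}{5}\right)$ is the Legendre symbol modulo 5. *)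

theory Defs
  imports "HOL-Analysis.Analysis"
begin

(* Ramanujan writes f(-q) for this product; f_neg takes q, not -q, as its argument. *)
definition f_neg :: "real \<Rightarrow> real" where
  "f_neg q = (\<Prod>n. 1 - q ^ Suc n)"

(* The Rogers-Ramanujan continued fraction, given by its product; meaningful for 0 < q < 1. *)
definition rr_cf :: "real \<Rightarrow> real" where
  "rr_cf q = q powr (1/5) *
     (\<Prod>n. ((1 - q ^ (5*n+1)) * (1 - q ^ (5*n+4))) / ((1 - q ^ (5*n+2)) * (1 - q ^ (5*n+3))))"

(* The first of the two equal expressions for N(q), i.e. the one through the derivative R'(q);
   the Lambert series form is a consequence of logarithmic differentiation of the product. *)
definition rr_N :: "real \<Rightarrow> real" where
  "rr_N q = q powr (5/6) * f_neg q powi (-4) * (deriv rr_cf q / rr_cf q)"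

end

theory Submission
  imports Defs
begin

text \<open>Write \<open>f\<^sub>m\<close> for \<open>f_neg (q ^ m)\<close>. The proof rests on one fact: multiplication by \<open>2 + i\<close> maps the
  Gaussian integers onto a sublattice of index 5, which splits into five products of residue
  classes. Applied to double theta series, each of whose factors is a product by the Jacobi triple
  product, this gives
  \<^item> \<open>\<psi>(q)\<^sup>2 - q \<psi>(q\<^sup>5)\<^sup>2 = f\<^sub>2 f\<^sub>5\<^sup>3 / (f\<^sub>1 f\<^sub>1\<^sub>0)\<close>,
  \<^item> \<open>\<phi>(-q\<^sup>5)\<^sup>2 - \<phi>(-q)\<^sup>2 = 4 q f\<^sub>1 f\<^sub>1\<^sub>0\<^sup>3 / (f\<^sub>2 f\<^sub>5)\<close>,
  \<^item> with weight \<open>X\<^sup>2 - Y\<^sup>2 = 3 (x\<^sup>2 - y\<^sup>2) - 8 x y\<close>, where \<open>(2 + i)(x + i y) = X + i Y\<close>: the Wronskian of the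
    two theta functions whose quotient is \<open>R\<close> is a multiple of \<open>f\<^sub>1\<^sup>6\<close>; the part \<open>x\<^sup>2 - y\<^sup>2\<close> cancels by symmetry
    and \<open>x y\<close> gives the square of Jacobi's series for \<open>f\<^sub>1\<^sup>3\<close>.

  The third identity says \<open>q R'(q) / R(q) = f\<^sub>1\<^sup>5 / (5 f\<^sub>5)\<close>, so \<open>N(q) = q\<^bsup>-1/6\<^esup> f\<^sub>1 / (5 f\<^sub>5)\<close>, and the first two
  eliminate to the relation between \<open>f\<^sub>1 / f\<^sub>5\<close> and \<open>f\<^sub>2 / f\<^sub>1\<^sub>0\<close>.\<close>

section \<open>Infinite products\<close>

definition qpoch :: "real \<Rightarrow> real \<Rightarrow> real" where
  "qpoch a q = (\<Prod>n. 1 - a * q ^ n)"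

lemma qpoch_convergent:
  fixes a q :: real
  assumes "\<bar>q\<bar> < 1"
  shows "convergent_prod (\<lambda>n. 1 - a * q ^ n)"
proof -
  have "summable (\<lambda>k. norm (1 - a * q ^ k - 1))"
    using assms by (simp add: abs_mult power_abs summable_mult summable_geometric)
  then show ?thesis
    by (intro abs_convergent_prod_imp_convergent_prod summable_imp_abs_convergent_prod)
qed

lemma qpoch_tendsto:
  assumes "\<bar>q\<bar> < 1"
  shows "(\<lambda>n. \<Prod>k<n. 1 - a * q ^ k) \<longlonglongrightarrow> qpoch a q"
  using convergent_prod_LIMSEQ[OF qpoch_convergent[OF assms]]
  unfolding qpoch_def by (subst (asm) LIMSEQ_lessThan_iff_atMost [symmetric])

lemma qpoch_eqI:
  assumes "\<bar>q\<bar> < 1" "(\<lambda>n. \<Prod>k<n. 1 - a * q ^ k) \<longlonglongrightarrow> L"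
  shows "qpoch a q = L"
  using LIMSEQ_unique[OF qpoch_tendsto[OF assms(1)] assms(2)] .

lemma qpoch_nonzero:
  assumes "\<bar>q\<bar> < 1" "\<And>n. a * q ^ n \<noteq> 1"
  shows "qpoch a q \<noteq> 0"
  using prodinf_nonzero[OF qpoch_convergent[OF assms(1)], of a] assms(2)
  unfolding qpoch_def by (metis eq_iff_diff_eq_0)

text \<open>The factors are sorted by the residue of their index modulo \<open>m\<close>. The
  partial products of length \<open>n * m\<close> already factor this way, and they form a
  subsequence with the same limit.\<close>

lemma qpoch_dissect:
  assumes "\<bar>q\<bar> < 1" "m > 0"
  shows "qpoch a q = (\<Prod>i<m. qpoch (a * q ^ i) (q ^ m))"
proof -
  have qm: "\<bar>q ^ m\<bar> < 1"
    using assms by (simp add: power_abs power_less_one_iff)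
  have "(\<lambda>n. \<Prod>i<m. \<Prod>k<n. 1 - (a * q ^ i) * (q ^ m) ^ k) \<longlonglongrightarrow> (\<Prod>i<m. qpoch (a * q ^ i) (q ^ m))"
    by (intro tendsto_prod qpoch_tendsto qm)
  also have "(\<lambda>n. \<Prod>i<m. \<Prod>k<n. 1 - (a * q ^ i) * (q ^ m) ^ k) = (\<lambda>n. \<Prod>k<n * m. 1 - a * q ^ k)"
  proof
    fix n
    have "(\<Prod>k<n * m. 1 - a * q ^ k) = (\<Prod>k<n. prod (\<lambda>k. 1 - a * q ^ k) {k * m..<k * m + m})"
      by (rule prod.nat_group[symmetric])
    also have "\<dots> = (\<Prod>k<n. \<Prod>i<m. 1 - a * q ^ (i + k * m))"
      using prod.shift_bounds_nat_ivl[of "\<lambda>k. 1 - a * q ^ k" 0 "_ * m" m]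
      by (intro prod.cong[OF refl, of "{..<n}"]) (simp add: atLeast0LessThan add.commute)
    finally show "(\<Prod>i<m. \<Prod>k<n. 1 - (a * q ^ i) * (q ^ m) ^ k) = (\<Prod>k<n * m. 1 - a * q ^ k)"
      by (subst prod.swap) (simp add: power_add power_mult[symmetric] mult_ac)
  qed
  finally have lim: "(\<lambda>n. \<Prod>k<n * m. 1 - a * q ^ k) \<longlonglongrightarrow> (\<Prod>i<m. qpoch (a * q ^ i) (q ^ m))" .
  have "filterlim (\<lambda>n. n * m) at_top sequentially"
    using assms(2) by (simp add: mult_nat_right_at_top)
  from filterlim_compose[OF qpoch_tendsto[OF assms(1)] this]
  have "(\<lambda>n. \<Prod>k<n * m. 1 - a * q ^ k) \<longlonglongrightarrow> qpoch a q" .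
  from LIMSEQ_unique[OF this lim] show ?thesis .
qed

lemma qpoch_mult_minus:
  assumes "\<bar>q\<bar> < 1"
  shows "qpoch a q * qpoch (- a) q = qpoch (a\<^sup>2) (q\<^sup>2)"
proof (rule qpoch_eqI[symmetric])
  show "\<bar>q\<^sup>2\<bar> < 1" using assms by (simp add: abs_square_less_1)
  have "(\<lambda>n. (\<Prod>k<n. 1 - a * q ^ k) * (\<Prod>k<n. 1 - (- a) * q ^ k)) \<longlonglongrightarrow> qpoch a q * qpoch (- a) q"
    by (intro tendsto_mult qpoch_tendsto assms)
  also have "(\<lambda>n. (\<Prod>k<n. 1 - a * q ^ k) * (\<Prod>k<n. 1 - (- a) * q ^ k)) = (\<lambda>n. \<Prod>k<n. 1 - a\<^sup>2 * (q\<^sup>2) ^ k)"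
    by (simp add: prod.distrib[symmetric] algebra_simps power2_eq_square power_mult_distrib)
  finally show "(\<lambda>n. \<Prod>k<n. 1 - a\<^sup>2 * (q\<^sup>2) ^ k) \<longlonglongrightarrow> qpoch a q * qpoch (- a) q" .
qed

section \<open>The Jacobi triple product\<close>

text \<open>For every integer \<open>j\<close> the product \<open>j * (j - 1)\<close> is even and
  nonnegative, so neither \<open>div\<close> nor \<open>nat\<close> loses anything.\<close>

definition tri :: "int \<Rightarrow> nat" where
  "tri j = nat (j * (j - 1) div 2)"

lemma two_tri: "2 * int (tri j) = j * (j - 1)"
proof -
  have "j * (j - 1) \<ge> 0"
    by (cases "j \<ge> 1") (auto simp: mult_nonpos_nonpos)
  moreover have "even (j * (j - 1))" by simp
  ultimately show ?thesis unfolding tri_def by (simp add: pos_imp_zdiv_nonneg_iff)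
qed

lemma power_tri_Suc:
  fixes q :: real
  assumes "q \<noteq> 0"
  shows "q ^ tri (j + 1) = q ^ tri j * q powi j"
proof -
  have "int (tri (j + 1)) = int (tri j) + j"
    using two_tri[of j] two_tri[of "j + 1"] by (simp add: algebra_simps)
  then have "q powi int (tri (j + 1)) = q powi (int (tri j) + j)"
    by simp
  then show ?thesis using assms by (simp add: power_int_add)
qed

section \<open>Finite form of the triple product\<close>

definition qfac :: "real \<Rightarrow> nat \<Rightarrow> real" where
  "qfac q n = (\<Prod>k<n. 1 - q * q ^ k)"

text \<open>The reciprocal \<open>q\<close>-factorial is extended by \<open>0\<close> to negative arguments, so that its
  recurrence holds for all integers and no boundary terms arise below.\<close>

definition rfac :: "real \<Rightarrow> int \<Rightarrow> real" where
  "rfac q m = (if m < 0 then 0 else 1 / qfac q (nat m))"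

lemma qfac_pos: "0 < q \<Longrightarrow> q < 1 \<Longrightarrow> qfac q n > 0"
  unfolding qfac_def
  by (intro prod_pos) (auto simp: power_Suc[symmetric] power_less_one_iff simp del: power_Suc)

lemma rfac_rec:
  assumes "0 < q" "q < 1"
  shows "rfac q (m - 1) = (1 - q powi m) * rfac q m"
proof (cases "m \<le> 0")
  case True
  then show ?thesis by (auto simp: rfac_def)
next
  case False
  then obtain n where m: "m = int (Suc n)"
    by (metis not_le nat_0_le int_nat_eq less_imp_Suc_add zero_less_imp_eq_int gr0_implies_Suc)
  have "1 - q * q ^ n \<noteq> 0"
    using assms power_Suc_less_one[of q n] by simp
  then show ?thesis unfolding m
    by (simp add: rfac_def qfac_def nat_add_distrib power_int_add)
qed

text \<open>The Gaussian binomial coefficient of \<open>2 n\<close> over \<open>n + j\<close>. By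
  the convention for \<open>rfac\<close> it vanishes when \<open>j\<close> lies outside
  \<open>-n..n\<close>.\<close>

definition jtp_coeff :: "real \<Rightarrow> nat \<Rightarrow> int \<Rightarrow> real" where
  "jtp_coeff q n j = qfac q (2 * n) * rfac q (int n + j) * rfac q (int n - j)"

text \<open>Comparison of coefficients of z^j after multiplication by (1 + z q^n)(1 + q^(n+1)/z) = 1
  + q^(2n+1) + q^n z + q^(n+1)/z.\<close>

lemma jtp_coeff_rec:
  assumes q: "0 < q" "q < 1"
  shows "jtp_coeff q (Suc n) j * q ^ tri j =
    (1 + q ^ (2 * n + 1)) * (jtp_coeff q n j * q ^ tri j)
    + q ^ n * (jtp_coeff q n (j - 1) * q ^ tri (j - 1))
    + q ^ (n + 1) * (jtp_coeff q n (j + 1) * q ^ tri (j + 1))"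
proof -
  define N where "N = q ^ n"
  define J where "J = q powi j"
  have nz: "N \<noteq> 0" "J \<noteq> 0" "q \<noteq> 0" using q by (auto simp: N_def J_def)
  \<comment> \<open>\<open>A\<close> and \<open>B\<close> carry the largest indices that occur. All
    other reciprocal factorials are multiples of them by \<open>rfac_rec\<close>, which leaves the
    rational identity \<open>key\<close> in \<open>q\<close>, \<open>N\<close> and
    \<open>J\<close>.\<close>
  define A where "A = rfac q (int n + 1 + j)"
  define B where "B = rfac q (int n + 1 - j)"
  have Np: "q powi int n = N" by (simp add: N_def)
  have pj: "q powi (int n + 1 + j) = q * N * J" "q powi (int n + j) = N * J"
    "q powi (int n + 1 - j) = q * N / J" "q powi (int n - j) = N / J"
    using nz Np by (auto simp: power_int_add power_int_diff J_def)
  have a1: "rfac q (int n + j) = (1 - q * N * J) * A"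
    using rfac_rec[OF q, of "int n + 1 + j"] pj by (simp add: A_def)
  have a2: "rfac q (int n + (j - 1)) = (1 - N * J) * ((1 - q * N * J) * A)"
    using rfac_rec[OF q, of "int n + j"] unfolding pj a1 by (simp add: add_diff_eq)
  have a3: "rfac q (int n + (j + 1)) = A" by (simp add: A_def algebra_simps)
  have b1: "rfac q (int n - j) = (1 - q * N / J) * B"
    using rfac_rec[OF q, of "int n + 1 - j"] pj by (simp add: B_def)
  have b2: "rfac q (int n - (j + 1)) = (1 - N / J) * ((1 - q * N / J) * B)"
    using rfac_rec[OF q, of "int n - j"] unfolding pj b1 by (simp add: diff_diff_eq)
  have b3: "rfac q (int n - (j - 1)) = B" by (simp add: B_def algebra_simps)
  have t1: "q ^ tri (j + 1) = q ^ tri j * J"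
    using power_tri_Suc[OF nz(3), of j] by (simp add: J_def)
  have t2: "q ^ tri (j - 1) = q ^ tri j * q / J"
    using power_tri_Suc[OF nz(3), of "j - 1"] nz by (simp add: J_def power_int_diff field_simps)
  have Q: "qfac q (2 * Suc n) = qfac q (2 * n) * (1 - q * N\<^sup>2) * (1 - q\<^sup>2 * N\<^sup>2)"
    by (simp add: qfac_def N_def power2_eq_square power_add[symmetric] mult_2)
  have c: "rfac q (int (Suc n) + j) = A" "rfac q (int (Suc n) - j) = B"
    by (simp_all add: A_def B_def algebra_simps)
  have pn: "q ^ (2 * n + 1) = q * N\<^sup>2" "q ^ (n + 1) = q * N"
    by (simp_all add: N_def power2_eq_square power_add mult_2)
  have key: "(1 - q * N\<^sup>2) * (1 - q\<^sup>2 * N\<^sup>2) =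
     (1 + q * N\<^sup>2) * ((1 - q * N * J) * (1 - q * N / J))
     + N * (q / J) * ((1 - N * J) * (1 - q * N * J))
     + q * N * J * ((1 - N / J) * (1 - q * N / J))"
    using nz by (simp add: field_simps) algebra
  have *: "f * k * k' * A * B * t =
      e * (f * (X * A) * (Y * B) * t) + N * (f * (W * (X * A)) * B * (t * q / J))
      + M * (f * A * (V * (Y * B)) * (t * J))"
    if "k * k' = e * (X * Y) + N * (q / J) * (W * X) + M * J * (V * Y)"
    for f k k' e X Y W V M t :: real
  proof -
    have "f * k * k' * A * B * t = f * A * B * t * (k * k')" by simp
    then show ?thesis unfolding that by (simp add: algebra_simps)
  qed
  show ?thesis
    unfolding jtp_coeff_def Q c a1 a2 a3 b1 b2 b3 t1 t2 pn N_def[symmetric]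
    by (rule *[OF key])
qed

lemma has_sum_int_shift:
  fixes f :: "int \<Rightarrow> real"
  shows "((\<lambda>j. f (j + c)) has_sum S) UNIV \<longleftrightarrow> (f has_sum S) UNIV"
  by (rule has_sum_reindex_bij_betw[OF bij_betw_byWitness[where f' = "\<lambda>j. j - c"]]) auto

text \<open>Induction on \<open>n\<close> by \<open>jtp_coeff_rec\<close>. Summing over all integers
  makes the shifts of \<open>j\<close> mere reindexings, without boundary terms.\<close>

lemma finite_jacobi_triple_product:
  fixes q z :: real
  assumes q: "0 < q" "q < 1" and z: "z \<noteq> 0"
  shows "((\<lambda>j. jtp_coeff q n j * (q ^ tri j * z powi j)) has_sum
           (\<Prod>k<n. (1 + z * q ^ k) * (1 + q ^ (k + 1) / z))) UNIV"
proof (induction n)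
  case 0
  have eq: "jtp_coeff q 0 j * (q ^ tri j * z powi j) = (if j = 0 then 1 else 0)" for j
    by (auto simp: jtp_coeff_def rfac_def qfac_def tri_def)
  show ?case unfolding eq
    by (intro has_sum_finite_neutralI[of "{0}"]) auto
next
  case (Suc n)
  define t where "t n j = jtp_coeff q n j * (q ^ tri j * z powi j)" for n j
  define G where "G = (\<Prod>k<n. (1 + z * q ^ k) * (1 + q ^ (k + 1) / z))"
  have IH: "(t n has_sum G) UNIV" using Suc unfolding t_def G_def .
  have IH1: "((\<lambda>j. t n (j - 1)) has_sum G) UNIV" "((\<lambda>j. t n (j + 1)) has_sum G) UNIV"
    using IH has_sum_int_shift[of "t n" "-1" G] has_sum_int_shift[of "t n" 1 G] by simp_all
  have "((\<lambda>j. (1 + q ^ (2 * n + 1)) * t n j + (q ^ n * z) * t n (j - 1) + (q ^ (n + 1) / z) * t n (j + 1))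
     has_sum ((1 + q ^ (2 * n + 1)) * G + (q ^ n * z) * G + (q ^ (n + 1) / z) * G)) UNIV"
    by (intro has_sum_add has_sum_cmult_right IH IH1)
  also have "(\<lambda>j. (1 + q ^ (2 * n + 1)) * t n j + (q ^ n * z) * t n (j - 1) + (q ^ (n + 1) / z) * t n (j + 1))
     = t (Suc n)"
  proof
    fix j
    have zz: "z powi (j - 1) = z powi j / z" "z powi (j + 1) = z powi j * z"
      using z by (simp_all add: power_int_diff power_int_add)
    show "(1 + q ^ (2 * n + 1)) * t n j + (q ^ n * z) * t n (j - 1) + (q ^ (n + 1) / z) * t n (j + 1)
      = t (Suc n) j"
      using arg_cong[OF jtp_coeff_rec[OF q, of n j], of "\<lambda>x. x * z powi j"] z
      unfolding t_def zz by (simp add: algebra_simps)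
  qed
  also have "(1 + q ^ (2 * n + 1)) * G + (q ^ n * z) * G + (q ^ (n + 1) / z) * G
    = G * ((1 + z * q ^ n) * (1 + q ^ (n + 1) / z))"
    using z by (simp add: field_simps power_add power_mult power2_eq_square)
  finally show ?case by (simp add: t_def G_def)
qed

text \<open>Tannery's theorem, carried to the integers by \<open>int_decode\<close>. It turns finite
  identities into infinite ones: the Gaussian binomials \<open>c n j\<close> have a limit
  \<open>L\<close> that does not depend on \<open>j\<close>.\<close>

lemma has_sum_int_tannery:
  fixes c :: "nat \<Rightarrow> int \<Rightarrow> real"
  assumes lim: "\<And>j. (\<lambda>n. c n j) \<longlonglongrightarrow> L"
    and bound: "\<And>n j. \<bar>c n j\<bar> \<le> C"
    and w: "(\<lambda>j. \<bar>w j\<bar>) summable_on UNIV"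
    and S: "\<And>n. ((\<lambda>j. c n j * w j) has_sum S n) UNIV" "S \<longlonglongrightarrow> T"
  shows "((\<lambda>j. L * w j) has_sum T) UNIV"
proof -
  have bij: "bij_betw int_decode UNIV UNIV" by (rule bij_int_decode)
  have sw: "summable (\<lambda>k. \<bar>w (int_decode k)\<bar>)"
    using w summable_on_reindex_bij_betw[OF bij, of "\<lambda>j. \<bar>w j\<bar>"]
    by (simp add: summable_on_imp_summable)
  have "summable (\<lambda>k. norm (L * w (int_decode k))) \<and>
      (\<lambda>n. \<Sum>k. c n (int_decode k) * w (int_decode k)) \<longlonglongrightarrow> (\<Sum>k. L * w (int_decode k))"
  proof -
    have "(\<lambda>n. c n (int_decode k) * w (int_decode k)) \<longlonglongrightarrow> L * w (int_decode k)" for k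
      by (intro tendsto_mult_right lim)
    moreover have "\<forall>\<^sub>F (k, n) in sequentially \<times>\<^sub>F sequentially.
        norm (c n (int_decode k) * w (int_decode k)) \<le> C * \<bar>w (int_decode k)\<bar>"
      using bound by (auto intro!: always_eventually mult_right_mono simp: abs_mult)
    moreover have "summable (\<lambda>k. C * \<bar>w (int_decode k)\<bar>)"
      by (intro summable_mult sw)
    ultimately show ?thesis
      using tannerys_theorem[of "\<lambda>k n. c n (int_decode k) * w (int_decode k)"
          "\<lambda>k. L * w (int_decode k)" sequentially "\<lambda>k. C * \<bar>w (int_decode k)\<bar>"] by simp
  qed
  moreover have "(\<Sum>k. c n (int_decode k) * w (int_decode k)) = S n" for n
    using S(1)[of n] has_sum_reindex_bij_betw[OF bij, of "\<lambda>j. c n j * w j" "S n"]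
    by (intro sums_unique[symmetric] has_sum_imp_sums) simp
  ultimately have sm: "summable (\<lambda>k. norm (L * w (int_decode k)))"
    and lim': "S \<longlonglongrightarrow> (\<Sum>k. L * w (int_decode k))"
    by simp_all
  have "((\<lambda>k. L * w (int_decode k)) has_sum T) UNIV"
    unfolding LIMSEQ_unique[OF S(2) lim']
    by (rule norm_summable_imp_has_sum[OF sm summable_sums[OF summable_norm_cancel[OF sm]]])
  then show ?thesis
    using has_sum_reindex_bij_betw[OF bij, of "\<lambda>j. L * w j" T] by simp
qed

section \<open>Passage to the limit in the finite identities\<close>

lemma qfac_tendsto:
  assumes "0 < q" "q < 1"
  shows "qfac q \<longlonglongrightarrow> qpoch q q"
  using qpoch_tendsto[of q q] assms unfolding qfac_def by simp

lemma qfac_bounds: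
  assumes q: "0 < q" "q < 1"
  shows "qfac q n \<le> 1" "qpoch q q \<le> qfac q n" "0 < qpoch q q"
proof -
  have *: "0 \<le> 1 - q * q ^ k" for k
    using power_le_one[of q "Suc k"] q by simp
  show "qfac q n \<le> 1"
    unfolding qfac_def using * q by (intro prod_le_1) auto
  have "decseq (qfac q)"
    unfolding decseq_Suc_iff
    using * q qfac_pos[OF q] by (auto simp: qfac_def intro!: mult_left_le prod_nonneg)
  then show le: "qpoch q q \<le> qfac q n" for n
    by (rule decseq_ge[OF _ qfac_tendsto[OF q]])
  have "0 \<le> qpoch q q"
    using qfac_pos[OF q] by (intro LIMSEQ_le_const[OF qfac_tendsto[OF q]]) (auto intro: less_imp_le)
  moreover have "q * q ^ k \<noteq> 1" for k
    using power_Suc_less_one[of q k] q by simp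
  ultimately show "0 < qpoch q q"
    using qpoch_nonzero[of q q] q by (simp add: order_less_le)
qed

lemma rfac_tendsto:
  assumes q: "0 < q" "q < 1" and f: "filterlim f at_top sequentially"
  shows "(\<lambda>n. rfac q (f n)) \<longlonglongrightarrow> 1 / qpoch q q"
proof (rule Lim_transform_eventually)
  have "filterlim (\<lambda>n. nat (f n)) at_top sequentially"
    by (rule filterlim_compose[OF filterlim_nat_sequentially f])
  from filterlim_compose[OF qfac_tendsto[OF q] this]
  show "(\<lambda>n. 1 / qfac q (nat (f n))) \<longlonglongrightarrow> 1 / qpoch q q"
    using qfac_bounds(3)[OF q] by (intro tendsto_intros) auto
  have "eventually (\<lambda>n. f n \<ge> 0) sequentially"
    using f by (auto simp: filterlim_at_top)
  then show "\<forall>\<^sub>F n in sequentially. 1 / qfac q (nat (f n)) = rfac q (f n)"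
    by eventually_elim (simp add: rfac_def)
qed

lemma jtp_coeff_tendsto:
  assumes q: "0 < q" "q < 1"
  shows "(\<lambda>n. jtp_coeff q n j) \<longlonglongrightarrow> 1 / qpoch q q"
proof -
  have "(\<lambda>n. qfac q (2 * n)) \<longlonglongrightarrow> qpoch q q"
    by (rule filterlim_compose[OF qfac_tendsto[OF q]]) (simp add: mult_nat_left_at_top)
  moreover have "filterlim (\<lambda>n. int n + j) at_top sequentially"
    unfolding filterlim_at_top eventually_sequentially
  proof
    fix Z :: int
    show "\<exists>N. \<forall>n\<ge>N. Z \<le> int n + j" by (intro exI[of _ "nat (Z - j)"]) auto
  qed
  moreover have "filterlim (\<lambda>n. int n - j) at_top sequentially"
    unfolding filterlim_at_top eventually_sequentially
  proof
    fix Z :: int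
    show "\<exists>N. \<forall>n\<ge>N. Z \<le> int n - j" by (intro exI[of _ "nat (Z + j)"]) auto
  qed
  ultimately have "(\<lambda>n. qfac q (2 * n) * rfac q (int n + j) * rfac q (int n - j))
      \<longlonglongrightarrow> qpoch q q * (1 / qpoch q q) * (1 / qpoch q q)"
    by (intro tendsto_mult rfac_tendsto q)
  then show ?thesis
    using qfac_bounds(3)[OF q] by (simp add: jtp_coeff_def)
qed

text \<open>The uniform bound for Tannery's theorem: \<open>qfac\<close> is at most 1 and decreases
  to a positive limit.\<close>

lemma jtp_coeff_bound:
  assumes q: "0 < q" "q < 1"
  shows "\<bar>jtp_coeff q n j\<bar> \<le> 1 / (qpoch q q)\<^sup>2"
proof -
  note b = qfac_bounds[OF q]
  have r: "0 \<le> rfac q m" "rfac q m \<le> 1 / qpoch q q" for m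
    using b(2)[of "nat m"] b(3) qfac_pos[OF q, of "nat m"]
    by (auto simp: rfac_def intro!: divide_left_mono)
  have "0 \<le> jtp_coeff q n j"
    unfolding jtp_coeff_def using r qfac_pos[OF q, of "2 * n"] by simp
  moreover have "jtp_coeff q n j \<le> 1 * (1 / qpoch q q) * (1 / qpoch q q)"
    unfolding jtp_coeff_def using r b(1,3) qfac_pos[OF q, of "2 * n"]
    by (intro mult_mono mult_nonneg_nonneg) (auto intro: less_imp_le)
  ultimately show ?thesis by (simp add: power2_eq_square)
qed

lemma summable_of_power_ratio:
  fixes g :: "nat \<Rightarrow> real"
  assumes q: "0 < q" "q < 1" and g: "\<And>n. g (Suc n) = g n * (K * q ^ n)"
  shows "summable (\<lambda>n. \<bar>g n\<bar>)"
proof -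
  have "(\<lambda>n. \<bar>K\<bar> * q ^ n) \<longlonglongrightarrow> \<bar>K\<bar> * 0"
    using q by (intro tendsto_intros LIMSEQ_power_zero) auto
  then have "eventually (\<lambda>n. \<bar>K\<bar> * q ^ n < 1/2) sequentially"
    by (rule order_tendstoD) auto
  then obtain N where N: "\<And>n. n \<ge> N \<Longrightarrow> \<bar>K\<bar> * q ^ n < 1/2"
    by (auto simp: eventually_sequentially)
  show ?thesis
  proof (rule summable_ratio_test[of "1/2" N])
    fix n assume "n \<ge> N"
    then have "\<bar>g n\<bar> * (\<bar>K\<bar> * q ^ n) \<le> \<bar>g n\<bar> * (1/2)"
      using N by (intro mult_left_mono) (auto intro: less_imp_le)
    then show "norm \<bar>g (Suc n)\<bar> \<le> 1/2 * norm \<bar>g n\<bar>"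
      using q by (simp add: g abs_mult)
  qed simp
qed

text \<open>Neighbouring terms have ratio z q^n going up and (q/z) q^n going down, and both tend to
  0.\<close>

lemma summable_on_theta:
  fixes q z :: real
  assumes q: "0 < q" "q < 1" and z: "z \<noteq> 0"
  shows "(\<lambda>j. \<bar>q ^ tri j * z powi j\<bar>) summable_on UNIV"
proof -
  let ?w = "\<lambda>j. q ^ tri j * z powi j"
  have "summable (\<lambda>n. \<bar>?w (int n)\<bar>)"
  proof (rule summable_of_power_ratio[OF q, where K = z])
    show "?w (int (Suc n)) = ?w (int n) * (z * q ^ n)" for n
      using power_tri_Suc[of q "int n"] q z by (simp add: add.commute[of 1] power_int_add)
  qed
  then have A: "(\<lambda>j. \<bar>?w j\<bar>) summable_on range int"
    by (subst summable_on_reindex) (auto simp: o_def intro!: norm_summable_imp_summable_on)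
  have "summable (\<lambda>n. \<bar>?w (- int n)\<bar>)"
  proof (rule summable_of_power_ratio[OF q, where K = "q / z"])
    fix n
    have "q ^ tri (- int n) = q ^ tri (- int (Suc n)) * q powi (- int (Suc n))"
      using power_tri_Suc[of q "- int (Suc n)"] q by simp
    then have "q ^ tri (- int (Suc n)) = q ^ tri (- int n) * q ^ Suc n"
      using q by (simp add: power_int_minus del: power_Suc of_nat_Suc)
    moreover have "z powi (- int (Suc n)) = z powi (- int n) / z"
      using z by (simp add: power_int_minus field_simps del: of_nat_Suc)
    ultimately show "?w (- int (Suc n)) = ?w (- int n) * (q / z * q ^ n)"
      by simp
  qed
  then have B: "(\<lambda>j. \<bar>?w j\<bar>) summable_on range (\<lambda>n. - int n)"
    by (subst summable_on_reindex) (auto simp: o_def inj_on_def intro!: norm_summable_imp_summable_on)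
  have "range int \<union> range (\<lambda>n. - int n) = UNIV"
  proof -
    have "j \<in> range int \<union> range (\<lambda>n. - int n)" for j :: int
      by (cases j rule: int_cases2) auto
    then show ?thesis by blast
  qed
  then show ?thesis
    using summable_on_union[OF A B] by simp
qed

text \<open>Lets a factor \<open>j\<close> in a theta series be absorbed by replacing
  \<open>z\<close> with \<open>2 * z\<close> and \<open>z / 2\<close>.\<close>

lemma abs_le_two_powi: "\<bar>real_of_int j\<bar> \<le> 2 powi j + (1/2) powi j"
proof (cases j rule: int_cases2)
  case (nonneg n)
  have "real n \<le> 2 ^ n" using of_nat_less_two_power[of n] by (simp add: less_imp_le)
  then show ?thesis using nonneg by (simp add: add_increasing2)
next
  case (nonpos n)
  have "real n \<le> 2 ^ n" using of_nat_less_two_power[of n] by (simp add: less_imp_le)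
  then have "real n \<le> inverse (2 ^ n) + 2 ^ n" by (simp add: add_increasing)
  then show ?thesis using nonpos by (simp add: power_int_minus power_divide)
qed

lemma summable_on_theta_times:
  fixes q z :: real
  assumes q: "0 < q" "q < 1" and z: "z \<noteq> 0"
  shows "(\<lambda>j. \<bar>q ^ tri j * (of_int j * z powi j)\<bar>) summable_on UNIV"
proof (rule summable_on_comparison_test)
  show "(\<lambda>j. \<bar>q ^ tri j * (2 * z) powi j\<bar> + \<bar>q ^ tri j * ((1/2) * z) powi j\<bar>) summable_on UNIV"
    using z by (intro summable_on_add summable_on_theta q) auto
  fix j
  have "\<bar>q ^ tri j * z powi j\<bar> * \<bar>real_of_int j\<bar> \<le> \<bar>q ^ tri j * z powi j\<bar> * (2 powi j + (1/2) powi j)"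
    by (intro mult_left_mono abs_le_two_powi) auto
  also have "\<dots> = \<bar>q ^ tri j * (2 * z) powi j\<bar> + \<bar>q ^ tri j * ((1/2) * z) powi j\<bar>"
  proof -
    have *: "\<bar>q ^ tri j * (c * z) powi j\<bar> = \<bar>q ^ tri j * z powi j\<bar> * c powi j" if "c > 0" for c :: real
    proof -
      have "\<bar>c powi j\<bar> = c powi j" using that by (intro abs_of_nonneg zero_le_power_int) simp
      then show ?thesis unfolding power_int_mult_distrib abs_mult by simp
    qed
    show ?thesis
      using *[of 2] *[of "1/2"] by (simp only: distrib_left zero_less_numeral half_gt_zero zero_less_one)
  qed
  finally show "\<bar>q ^ tri j * (of_int j * z powi j)\<bar> \<le> \<bar>q ^ tri j * (2 * z) powi j\<bar> + \<bar>q ^ tri j * ((1/2) * z) powi j\<bar>"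
    by (simp add: abs_mult mult_ac)
qed auto

theorem jacobi_triple_product:
  fixes q z :: real
  assumes q: "0 < q" "q < 1" and z: "z \<noteq> 0"
  shows "((\<lambda>j. q ^ tri j * z powi j) has_sum qpoch q q * qpoch (- z) q * qpoch (- (q / z)) q) UNIV"
proof -
  have S: "(\<lambda>n. \<Prod>k<n. (1 + z * q ^ k) * (1 + q ^ (k + 1) / z)) \<longlonglongrightarrow> qpoch (- z) q * qpoch (- (q / z)) q"
    using tendsto_mult[OF qpoch_tendsto[of q "- z"] qpoch_tendsto[of q "- (q / z)"]] q
    by (simp add: prod.distrib)
  have "((\<lambda>j. 1 / qpoch q q * (q ^ tri j * z powi j)) has_sum qpoch (- z) q * qpoch (- (q / z)) q) UNIV"
    by (rule has_sum_int_tannery[OF jtp_coeff_tendsto[OF q] jtp_coeff_bound[OF q]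
          summable_on_theta[OF q z] finite_jacobi_triple_product[OF q z] S])
  from has_sum_cmult_right[OF this, of "qpoch q q"] show ?thesis
    using qfac_bounds(3)[OF q] by (simp add: mult.assoc)
qed

text \<open>The finite product contains the factor \<open>1 + z\<close>, so its derivative at -1 is
  the value there of the remaining product. Since only finitely many terms are nonzero, the series
  is differentiated as a finite sum.\<close>

lemma finite_jacobi_cube:
  assumes q: "0 < q" "q < 1"
  shows "((\<lambda>j. jtp_coeff q (Suc m) j * (q ^ tri j * (of_int j * (-1) powi (j - 1))))
           has_sum qfac q m * qfac q (Suc m)) UNIV"
proof -
  define n where "n = Suc m"
  define c where "c j = jtp_coeff q n j * q ^ tri j" for j
  define K where "K z = (\<Prod>k<m. 1 + z * q ^ Suc k) * (\<Prod>k<n. 1 + q ^ (k + 1) / z)" for z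
  define F where "F z = (\<Sum>j=-int n..int n. c j * z powi j)" for z
  have c0: "c j = 0" if "j \<notin> {-int n..int n}" for j
    using that by (auto simp: c_def jtp_coeff_def rfac_def)
  have F: "F z = (1 + z) * K z" if "z \<noteq> 0" for z
  proof -
    have "((\<lambda>j. c j * z powi j) has_sum F z) UNIV"
      unfolding F_def by (rule has_sum_finite_neutralI[of "{-int n..int n}"]) (use c0 in auto)
    moreover have "((\<lambda>j. c j * z powi j) has_sum (\<Prod>k<n. (1 + z * q ^ k) * (1 + q ^ (k + 1) / z))) UNIV"
      using finite_jacobi_triple_product[OF q that, of n] by (simp add: c_def mult.assoc)
    ultimately have "F z = (\<Prod>k<n. (1 + z * q ^ k) * (1 + q ^ (k + 1) / z))"
      by (rule has_sum_unique)
    also have "\<dots> = (1 + z) * K z"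
      unfolding prod.distrib K_def n_def
      by (subst prod.lessThan_Suc_shift) (simp add: mult.assoc)
    finally show ?thesis .
  qed
  \<comment> \<open>By Caratheodory's criterion, continuity of \<open>K\<close> alone gives the
    derivative of \<open>(1 + z) * K z\<close> at -1.\<close>
  have "isCont K (-1)"
    unfolding K_def by (intro continuous_intros) auto
  then have "((\<lambda>z. (1 + z) * K z) has_field_derivative K (-1)) (at (-1))"
    unfolding CARAT_DERIV by (intro exI[of _ K]) (auto simp: algebra_simps)
  then have 1: "(F has_field_derivative K (-1)) (at (-1))"
    by (rule has_field_derivative_transform_within_open[of _ _ _ "{..<0}"]) (auto simp: F)
  have 2: "(F has_field_derivative (\<Sum>j=-int n..int n. c j * (of_int j * (-1) powi (j - 1)))) (at (-1))"
    unfolding F_def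
  proof (rule DERIV_sum)
    show "((\<lambda>z. c j * z powi j) has_field_derivative c j * (of_int j * (-1) powi (j - 1))) (at (-1))" for j
      by (intro DERIV_cmult DERIV_power_int[where f = "\<lambda>z. z" and d = 1, simplified]) (auto)
  qed
  have "K (-1) = (\<Sum>j=-int n..int n. c j * (of_int j * (-1) powi (j - 1)))"
    by (rule DERIV_unique[OF 1 2])
  moreover have "K (-1) = qfac q m * qfac q n"
    by (simp add: K_def qfac_def)
  ultimately have "((\<lambda>j. c j * (of_int j * (-1) powi (j - 1))) has_sum qfac q m * qfac q n) UNIV"
    by (intro has_sum_finite_neutralI[of "{-int n..int n}"]) (use c0 in auto)
  then show ?thesis by (simp add: c_def n_def mult.assoc)
qed

text \<open>Limit of the finite version. Pairing \<open>j = n + 1\<close> with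
  \<open>j = - n\<close> gives Jacobi's usual series with terms (-1)^n (2n+1) q^(n(n+1)/2).\<close>

theorem jacobi_cube:
  assumes q: "0 < q" "q < 1"
  shows "((\<lambda>j. q ^ tri j * (of_int j * (-1) powi (j - 1))) has_sum qpoch q q ^ 3) UNIV"
proof -
  have S: "(\<lambda>m. qfac q m * qfac q (Suc m)) \<longlonglongrightarrow> qpoch q q * qpoch q q"
    by (intro tendsto_mult qfac_tendsto[OF q] LIMSEQ_Suc[OF qfac_tendsto[OF q]])
  have w: "(\<lambda>j. \<bar>q ^ tri j * (of_int j * (-1) powi (j - 1))\<bar>) summable_on UNIV"
    using summable_on_theta_times[OF q, of "-1"] by (simp add: abs_mult power_int_abs)
  have "((\<lambda>j. 1 / qpoch q q * (q ^ tri j * (of_int j * (-1) powi (j - 1)))) has_sum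
        qpoch q q * qpoch q q) UNIV"
    by (rule has_sum_int_tannery[OF LIMSEQ_Suc[OF jtp_coeff_tendsto[OF q]] jtp_coeff_bound[OF q]
          w finite_jacobi_cube[OF q] S])
  from has_sum_cmult_right[OF this, of "qpoch q q"] show ?thesis
    using qfac_bounds(3)[OF q] by (simp add: mult.assoc power3_eq_cube)
qed

section \<open>Double theta series over the Gaussian integers\<close>

definition sg :: "int \<Rightarrow> real" where
  "sg n = (if even n then 1 else -1)"

lemma minus_one_powi: "(-1) powi n = sg n"
  by (cases n rule: int_cases2) (auto simp: sg_def power_int_minus)

text \<open>The triple product with base \<open>q ^ b\<close> and \<open>z = s * q ^ a\<close>,
  where \<open>1 / s = s\<close>. The exponent \<open>E\<close> is left abstract so that
  \<open>tri\<close>, \<open>sq\<close>, \<open>pent\<close> and \<open>dec\<close> are all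
  covered.\<close>

lemma has_sum_theta:
  fixes q s :: real and a b :: nat and E :: "int \<Rightarrow> nat"
  assumes q: "0 < q" "q < 1" and s: "s = 1 \<or> s = -1" and ab: "a \<le> b" "b > 0"
    and E: "\<And>n. 2 * int (E n) = int b * (n * (n - 1)) + 2 * int a * n"
  shows "((\<lambda>n. s powi n * q ^ E n) has_sum
     qpoch (q ^ b) (q ^ b) * qpoch (- (s * q ^ a)) (q ^ b) * qpoch (- (s * q ^ (b - a))) (q ^ b)) UNIV"
proof -
  have Q: "0 < q ^ b" "q ^ b < 1" "s * q ^ a \<noteq> 0"
    using q s ab by (auto simp: power_less_one_iff)
  have 1: "q ^ b / (s * q ^ a) = s * q ^ (b - a)"
    using q s ab(1) by (auto simp: power_diff)
  have 2: "(q ^ b) ^ tri n * (s * q ^ a) powi n = s powi n * q ^ E n" for n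
  proof -
    have "2 * int (E n) = 2 * (int (b * tri n) + int a * n)"
      using E[of n] arg_cong[OF two_tri[of n], of "\<lambda>x. int b * x"] by (simp add: algebra_simps)
    then have "int (E n) = int (b * tri n) + int a * n"
      unfolding mult_cancel_left by simp
    then have "q powi int (E n) = q powi (int (b * tri n) + int a * n)"
      by simp
    then have "q ^ E n = q ^ (b * tri n) * (q ^ a) powi n"
      using q by (simp add: power_int_add power_int_mult del: of_nat_mult)
    then show ?thesis
      by (simp add: power_int_mult_distrib power_mult)
  qed
  show ?thesis
    using jacobi_triple_product[OF Q] unfolding 1 2 .
qed

text \<open>Real summability in the sense of \<open>has_sum\<close> is absolute, which makes the
  product family summable over all pairs.\<close>

lemma has_sum_product:
  fixes f :: "'a \<Rightarrow> real" and g :: "'b \<Rightarrow> real"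
  assumes f: "(f has_sum a) UNIV" and g: "(g has_sum b) UNIV"
  shows "((\<lambda>(m, n). f m * g n) has_sum a * b) UNIV"
proof -
  have fa: "(\<lambda>x. \<bar>f x\<bar>) summable_on UNIV" and ga: "(\<lambda>x. \<bar>g x\<bar>) summable_on UNIV"
    using summable_on_iff_abs_summable_on_real[THEN iffD1, OF has_sum_imp_summable[OF f]]
      summable_on_iff_abs_summable_on_real[THEN iffD1, OF has_sum_imp_summable[OF g]] by simp_all
  have "(\<lambda>p. \<bar>f (fst p) * g (snd p)\<bar>) summable_on (UNIV \<times> UNIV)"
  proof (rule summable_on_SigmaI)
    show "((\<lambda>y. \<bar>f (fst (x, y)) * g (snd (x, y))\<bar>) has_sum \<bar>f x\<bar> * infsum (\<lambda>y. \<bar>g y\<bar>) UNIV) UNIV" for x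
      unfolding abs_mult fst_conv snd_conv by (intro has_sum_cmult_right has_sum_infsum ga)
    show "(\<lambda>x. \<bar>f x\<bar> * infsum (\<lambda>y. \<bar>g y\<bar>) UNIV) summable_on UNIV"
      by (intro summable_on_cmult_left fa)
  qed auto
  then have "(\<lambda>p. f (fst p) * g (snd p)) summable_on (UNIV \<times> UNIV)"
    by (subst summable_on_iff_abs_summable_on_real) simp
  moreover have "((\<lambda>y. f (fst (x, y)) * g (snd (x, y))) has_sum f x * b) UNIV" for x
    using has_sum_cmult_right[OF g] by simp
  moreover have "((\<lambda>x. f x * b) has_sum a * b) UNIV"
    by (intro has_sum_cmult_left f)
  ultimately have "((\<lambda>p. f (fst p) * g (snd p)) has_sum a * b) (UNIV \<times> UNIV)"
    by (intro has_sum_SigmaI[where g = "\<lambda>x. f x * b"]) auto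
  then show ?thesis by (simp add: case_prod_unfold)
qed

text \<open>Multiplication by \<open>2 + i\<close> on the Gaussian integers: with \<open>X = 2 x - y\<close> and \<open>Y = x + 2 y\<close>
  the image is the set of pairs with \<open>Y \<equiv> 3 X\<close> modulo 5, split here by \<open>c = X mod 5\<close>.\<close>

lemma has_sum_gaussian_split:
  fixes g :: "int \<Rightarrow> int \<Rightarrow> real"
  assumes "\<And>c. c \<in> {0, 1, 2, 3, 4} \<Longrightarrow>
    ((\<lambda>(m, n). g (2 * m + n + c) (2 * n - m + c)) has_sum S c) UNIV"
  shows "((\<lambda>(i, j). g i j) has_sum (S 0 + S 1 + S 2 + S 3 + S 4)) UNIV"
proof -
  define L :: "int \<Rightarrow> int \<times> int \<Rightarrow> int \<times> int"
    where "L c = (\<lambda>(m, n). (2 * m + n + c, 2 * n - m + c))" for c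
  let ?C = "{0, 1, 2, 3, 4 :: int}"
  have inj: "inj (L c)" for c
    by (auto simp: L_def inj_on_def)
  have sum_c: "((\<lambda>(i, j). g i j) has_sum S c) (range (L c))" if "c \<in> ?C" for c
    using assms[OF that] by (subst has_sum_reindex[OF inj]) (simp add: o_def L_def case_prod_unfold)
  \<comment> \<open>On class \<open>c\<close> the coordinate \<open>2 * i - j\<close> equals
    \<open>5 * m + c\<close>; its residue recovers \<open>c\<close>, so the classes are
    disjoint.\<close>
  have mod: "(2 * i - j) mod 5 = c" if "(i, j) \<in> range (L c)" "c \<in> ?C" for i j c
  proof -
    from that(1) obtain m where "2 * i - j = c + m * 5"
      by (auto simp: L_def)
    then show ?thesis using that(2) by auto
  qed
  have "((\<lambda>(i, j). g i j) has_sum sum S ?C) (\<Union>c\<in>?C. range (L c))"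
  proof (rule sum_has_sum)
    show "range (L c) \<inter> range (L c') = {}" if "c \<in> ?C" "c' \<in> ?C" "c \<noteq> c'" for c c'
    proof (rule equals0I)
      fix p assume "p \<in> range (L c) \<inter> range (L c')"
      then have "(fst p, snd p) \<in> range (L c)" "(fst p, snd p) \<in> range (L c')" by auto
      from mod[OF this(1) that(1)] mod[OF this(2) that(2)] that(3) show False by simp
    qed
  qed (use sum_c in auto)
  moreover have "(i, j) \<in> (\<Union>c\<in>?C. range (L c))" for i j
  proof -
    \<comment> \<open>Division of \<open>2 * i - j\<close> by 5 yields \<open>c\<close> and
      \<open>m\<close>; the other index is forced by \<open>i = 2 * m + n + c\<close>.\<close>
    define c where "c = (2 * i - j) mod 5"
    define m where "m = (2 * i - j) div 5"
    have *: "2 * i - j = 5 * m + c" by (simp add: c_def m_def)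
    have "L c (m, i - 2 * m - c) = (i, j)" using * by (simp add: L_def)
    moreover have "0 \<le> c" "c < 5" by (simp_all add: c_def)
    then have "c \<in> ?C" by auto
    ultimately show ?thesis by (metis UN_I rangeI)
  qed
  then have "(\<Union>c\<in>?C. range (L c)) = UNIV" by auto
  ultimately show ?thesis by (simp add: add.assoc)
qed

text \<open>Several classes of the splitting carry the same double series up to translations,
  reflections and, in the second part, an exchange of the two indices.\<close>

lemma has_sum_int2_affine:
  fixes F :: "int \<Rightarrow> int \<Rightarrow> real"
  assumes F: "((\<lambda>(m, n). F m n) has_sum S) UNIV"
    and s: "s = 1 \<or> s = -1" and t: "t = 1 \<or> t = -1"
  shows "((\<lambda>(m, n). F (a + s * m) (b + t * n)) has_sum S) UNIV"
    and "((\<lambda>(m, n). F (b + t * n) (a + s * m)) has_sum S) UNIV"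
proof -
  have "bij_betw (\<lambda>(m, n). (a + s * m, b + t * n)) UNIV UNIV"
    by (rule bij_betw_byWitness[where f' = "\<lambda>(m, n). (s * (m - a), t * (n - b))"])
      (use s t in auto)
  from has_sum_reindex_bij_betw[OF this, of "\<lambda>(m, n). F m n" S] F
  show "((\<lambda>(m, n). F (a + s * m) (b + t * n)) has_sum S) UNIV"
    by (simp add: case_prod_unfold)
  have "bij_betw (\<lambda>(m, n). (b + t * n, a + s * m)) UNIV UNIV"
    by (rule bij_betw_byWitness[where f' = "\<lambda>(n, m). (s * (m - a), t * (n - b))"])
      (use s t in auto)
  from has_sum_reindex_bij_betw[OF this, of "\<lambda>(m, n). F m n" S] F
  show "((\<lambda>(m, n). F (b + t * n) (a + s * m)) has_sum S) UNIV"
    by (simp add: case_prod_unfold)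
qed

text \<open>For \<open>c = 1\<close> and \<open>c = 3\<close> these are the exponents of the two
  theta functions whose quotient is \<open>R\<close>, up to the factor q^(1/5).\<close>

definition pent :: "int \<Rightarrow> int \<Rightarrow> nat" where
  "pent c n = nat (n * (5 * n - c) div 2)"

lemma two_pent:
  assumes "odd c" "\<bar>c\<bar> \<le> 5"
  shows "2 * int (pent c n) = 5 * n\<^sup>2 - c * n"
proof -
  have "n * (5 * n - c) \<ge> 0"
  proof (cases n "0 :: int" rule: linorder_cases)
    case less
    then show ?thesis using assms(2) by (intro mult_nonpos_nonpos) auto
  next
    case greater
    then show ?thesis using assms(2) by (intro mult_nonneg_nonneg) auto
  qed auto
  moreover have "even (n * (5 * n - c))" using assms(1) by simp
  ultimately show ?thesis
    unfolding pent_def by (simp add: pos_imp_zdiv_nonneg_iff algebra_simps power2_eq_square)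
qed

text \<open>The difference of two values is a multiple of (m - n)(5(m + n) - c), and 5 does not
  divide \<open>c\<close>. Distinct exponents are what \<open>has_sum_theta_deriv\<close>
  requires.\<close>

lemma inj_pent:
  assumes "c \<in> {1, 3}"
  shows "inj (pent c)"
proof (rule injI)
  fix m n assume "pent c m = pent c n"
  then have "5 * m\<^sup>2 - c * m = 5 * n\<^sup>2 - c * n"
    using two_pent[of c m] two_pent[of c n] assms by auto
  then have "(m - n) * (5 * (m + n) - c) = 0"
    by (simp add: algebra_simps power2_eq_square)
  moreover have "5 * (m + n) - c \<noteq> 0"
    using assms by (auto; presburger)
  ultimately show "m = n" by simp
qed

text \<open>For \<open>x = 2 i - 1\<close> one has \<open>8 tri i + 1 = x\<^sup>2\<close>, and \<open>40 pent 1 m + 1 = (10 m - 1)\<^sup>2\<close>,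
  \<open>40 pent 3 n + 9 = (10 n - 3)\<^sup>2\<close>. The identities below all express \<open>X\<^sup>2 + Y\<^sup>2 = 5 (x\<^sup>2 + y\<^sup>2)\<close>
  with \<open>X + i Y = (2 + i) (x + i y)\<close>; the class of \<open>X\<close> and \<open>Y\<close> divisible by 5 is \<open>c = 3\<close>.\<close>

lemma tri_gaussian:
  "tri (2 * m + n) + tri (2 * n - m) = pent 1 m + pent 3 n"
  "tri (2 * m + n + 1) + tri (2 * n - m + 1) = pent 1 (- m) + pent 3 (- n)"
  "tri (2 * m + n + 2) + tri (2 * n - m + 2) = pent 1 (1 + n) + pent 3 (- m)"
  "tri (2 * m + n + 3) + tri (2 * n - m + 3) = 1 + 5 * (tri (1 + m) + tri (2 + n))"
  "tri (2 * m + n + 4) + tri (2 * n - m + 4) = pent 1 (- 2 - n) + pent 3 (1 + m)"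
proof -
  \<comment> \<open>Doubling removes the halves hidden in \<open>tri\<close> and \<open>pent\<close>
    and leaves quadratic identities over the integers.\<close>
  have T: "A = B" if "2 * int A = 2 * int B" for A B
    using that by simp
  show "tri (2 * m + n) + tri (2 * n - m) = pent 1 m + pent 3 n"
    using two_tri[of "2 * m + n"] two_tri[of "2 * n - m"] two_pent[of 1 m] two_pent[of 3 n]
    by (intro T) (simp add: power2_eq_square algebra_simps)
  show "tri (2 * m + n + 1) + tri (2 * n - m + 1) = pent 1 (- m) + pent 3 (- n)"
    using two_tri[of "2 * m + n + 1"] two_tri[of "2 * n - m + 1"] two_pent[of 1 "-m"] two_pent[of 3 "-n"]
    by (intro T) (simp add: power2_eq_square algebra_simps)
  show "tri (2 * m + n + 2) + tri (2 * n - m + 2) = pent 1 (1 + n) + pent 3 (- m)"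
    using two_tri[of "2 * m + n + 2"] two_tri[of "2 * n - m + 2"] two_pent[of 1 "1+n"] two_pent[of 3 "-m"]
    by (intro T) (simp add: power2_eq_square algebra_simps)
  show "tri (2 * m + n + 3) + tri (2 * n - m + 3) = 1 + 5 * (tri (1 + m) + tri (2 + n))"
    using two_tri[of "2 * m + n + 3"] two_tri[of "2 * n - m + 3"] two_tri[of "1+m"] two_tri[of "2+n"]
    by (intro T) (simp add: power2_eq_square algebra_simps)
  show "tri (2 * m + n + 4) + tri (2 * n - m + 4) = pent 1 (- 2 - n) + pent 3 (1 + m)"
    using two_tri[of "2 * m + n + 4"] two_tri[of "2 * n - m + 4"] two_pent[of 1 "-2-n"] two_pent[of 3 "1+m"]
    by (intro T) (simp add: power2_eq_square algebra_simps)
qed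

text \<open>In the splitting of the square of the \<open>tri\<close> series, class 3 contributes
  \<open>q * P5\<^sup>2\<close> and each of the other four classes contributes
  \<open>H1 * H3\<close>.\<close>

lemma psi_gaussian:
  fixes q :: real
  assumes P: "((\<lambda>n. q ^ tri n) has_sum P) UNIV" "((\<lambda>n. (q ^ 5) ^ tri n) has_sum P5) UNIV"
    and H: "((\<lambda>n. q ^ pent 1 n) has_sum H1) UNIV" "((\<lambda>n. q ^ pent 3 n) has_sum H3) UNIV"
  shows "P\<^sup>2 - q * P5\<^sup>2 = 4 * H1 * H3"
proof -
  let ?S = "\<lambda>c::int. if c = 3 then q * (P5 * P5) else H1 * H3"
  have A: "((\<lambda>(m, n). q ^ pent 1 m * q ^ pent 3 n) has_sum H1 * H3) UNIV"
    by (rule has_sum_product[OF H])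
  have B: "((\<lambda>(m, n). q * ((q ^ 5) ^ tri m * (q ^ 5) ^ tri n)) has_sum q * (P5 * P5)) UNIV"
    using has_sum_cmult_right[OF has_sum_product[OF P(2) P(2)], of q]
    by (simp add: case_prod_unfold)
  have e: "q ^ tri i * q ^ tri j = q ^ (tri i + tri j)" for i j
    by (simp add: power_add)
  have "((\<lambda>(i, j). q ^ tri i * q ^ tri j) has_sum (?S 0 + ?S 1 + ?S 2 + ?S 3 + ?S 4)) UNIV"
  proof (rule has_sum_gaussian_split)
    fix c :: int assume "c \<in> {0, 1, 2, 3, 4}"
    then consider "c = 0" | "c = 1" | "c = 2" | "c = 3" | "c = 4" by auto
    then show "((\<lambda>(m, n). q ^ tri (2 * m + n + c) * q ^ tri (2 * n - m + c)) has_sum ?S c) UNIV"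
      unfolding e
    proof cases
      case 1 with A show "((\<lambda>(m, n). q ^ (tri (2 * m + n + c) + tri (2 * n - m + c))) has_sum ?S c) UNIV"
        by (simp add: tri_gaussian power_add)
    next
      case 2 with has_sum_int2_affine(1)[OF A, where s = "-1" and t = "-1" and a = 0 and b = 0]
      show "((\<lambda>(m, n). q ^ (tri (2 * m + n + c) + tri (2 * n - m + c))) has_sum ?S c) UNIV"
        by (simp add: tri_gaussian power_add)
    next
      case 3 with has_sum_int2_affine(2)[OF A, where s = "-1" and t = 1 and a = 0 and b = 1]
      show "((\<lambda>(m, n). q ^ (tri (2 * m + n + c) + tri (2 * n - m + c))) has_sum ?S c) UNIV"
        by (simp add: tri_gaussian power_add)
    next
      case 4 with has_sum_int2_affine(1)[OF B, where s = 1 and t = 1 and a = 1 and b = 2]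
      show "((\<lambda>(m, n). q ^ (tri (2 * m + n + c) + tri (2 * n - m + c))) has_sum ?S c) UNIV"
        by (simp add: tri_gaussian power_add power_mult distrib_left)
    next
      case 5 with has_sum_int2_affine(2)[OF A, where s = 1 and t = "-1" and a = 1 and b = "-2"]
      show "((\<lambda>(m, n). q ^ (tri (2 * m + n + c) + tri (2 * n - m + c))) has_sum ?S c) UNIV"
        by (simp add: tri_gaussian power_add)
    qed
  qed
  from has_sum_unique[OF this has_sum_product[OF P(1) P(1)]]
  show ?thesis by (simp add: power2_eq_square)
qed

section \<open>Signed series of squares\<close>

lemma sg_simps [simp]: "sg (1 + n) = - sg n" "sg (2 + n) = sg n" "sg (- n) = sg n"
  "sg (- 1 - n) = - sg n" "sg (- 2 - n) = sg n"
  by (auto simp: sg_def)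

text \<open>Modulo 2 the arguments are \<open>n + c\<close> and \<open>m + c\<close>, so the two
  signs of \<open>c\<close> cancel.\<close>

lemma sg_gaussian: "sg (2 * m + n + c) * sg (2 * n - m + c) = sg m * sg n"
  by (auto simp: sg_def)

definition sq :: "int \<Rightarrow> nat" where "sq n = nat (n\<^sup>2)"

lemma int_sq: "int (sq n) = n\<^sup>2"
  by (simp add: sq_def)

text \<open>For \<open>c = 2\<close> and \<open>c = 4\<close> these are the exponents of the theta
  series with base \<open>q ^ 10\<close>.\<close>

definition dec :: "int \<Rightarrow> int \<Rightarrow> nat" where "dec c n = nat (n * (5 * n - c))"

lemma int_dec:
  assumes "\<bar>c\<bar> \<le> 5"
  shows "int (dec c n) = 5 * n\<^sup>2 - c * n"
proof -
  have "n * (5 * n - c) \<ge> 0"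
  proof (cases n "0 :: int" rule: linorder_cases)
    case less
    then show ?thesis using assms by (intro mult_nonpos_nonpos) auto
  next
    case greater
    then show ?thesis using assms by (intro mult_nonneg_nonneg) auto
  qed auto
  then show ?thesis by (simp add: dec_def algebra_simps power2_eq_square)
qed

text \<open>The squares are centred at the origin, so here the class divisible by 5 is
  \<open>c = 0\<close>, with factor |2 + i|^2 = 5.\<close>

lemma sq_gaussian:
  "sq (2 * m + n) + sq (2 * n - m) = 5 * (sq m + sq n)"
  "sq (2 * m + n + 1) + sq (2 * n - m + 1) = 1 + (dec 2 (- m) + dec 4 (1 + n))"
  "sq (2 * m + n + 2) + sq (2 * n - m + 2) = 1 + (dec 2 (- 1 - n) + dec 4 (- m))"
  "sq (2 * m + n + 3) + sq (2 * n - m + 3) = 1 + (dec 2 (2 + n) + dec 4 (1 + m))"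
  "sq (2 * m + n + 4) + sq (2 * n - m + 4) = 1 + (dec 2 (1 + m) + dec 4 (- 2 - n))"
  by (simp_all add: of_nat_eq_iff[where ?'a = int, symmetric] int_sq int_dec power2_eq_square algebra_simps)

text \<open>Class 0 contributes \<open>P5\<^sup>2\<close>, and each of the other four classes
  contributes \<open>- q * (G2 * G4)\<close>.\<close>

lemma phi_gaussian:
  fixes q :: real
  assumes P: "((\<lambda>n. sg n * q ^ sq n) has_sum P) UNIV" "((\<lambda>n. sg n * (q ^ 5) ^ sq n) has_sum P5) UNIV"
    and G: "((\<lambda>n. sg n * q ^ dec 2 n) has_sum G2) UNIV" "((\<lambda>n. sg n * q ^ dec 4 n) has_sum G4) UNIV"
  shows "P5\<^sup>2 - P\<^sup>2 = 4 * q * (G2 * G4)"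
proof -
  \<comment> \<open>The minus sign is cancelled in each substitution below, since the two
    translations always add up to an odd number.\<close>
  define F where "F m n = - (sg m * sg n * q ^ (1 + (dec 2 m + dec 4 n)))" for m n
  let ?S = "\<lambda>c::int. if c = 0 then P5 * P5 else - (q * (G2 * G4))"
  have e: "sg i * q ^ x * (sg j * q ^ y) = sg i * sg j * q ^ (x + y)" for i j x y
    by (simp add: power_add)
  have A: "((\<lambda>(m, n). F m n) has_sum - (q * (G2 * G4))) UNIV"
    using has_sum_uminusI[OF has_sum_cmult_right[OF has_sum_product[OF G], of q]]
    unfolding F_def e by (simp add: case_prod_unfold mult_ac)
  have B: "((\<lambda>(m, n). sg m * sg n * q ^ (5 * (sq m + sq n))) has_sum P5 * P5) UNIV"
  proof -
    have "sg m * (q ^ 5) ^ x * (sg n * (q ^ 5) ^ y) = sg m * sg n * q ^ (5 * (x + y))" for m n x y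
      by (simp add: distrib_left power_add power_mult)
    then show ?thesis using has_sum_product[OF P(2) P(2)] by (simp only:) 
  qed
  have "((\<lambda>(i, j). sg i * sg j * q ^ (sq i + sq j)) has_sum (?S 0 + ?S 1 + ?S 2 + ?S 3 + ?S 4)) UNIV"
  proof (rule has_sum_gaussian_split)
    fix c :: int assume "c \<in> {0, 1, 2, 3, 4}"
    then consider "c = 0" | "c = 1" | "c = 2" | "c = 3" | "c = 4" by auto
    then show "((\<lambda>(m, n). sg (2 * m + n + c) * sg (2 * n - m + c) *
        q ^ (sq (2 * m + n + c) + sq (2 * n - m + c))) has_sum ?S c) UNIV"
      unfolding sg_gaussian
    proof cases
      case 1 with B show "((\<lambda>(m, n). sg m * sg n * q ^ (sq (2 * m + n + c) + sq (2 * n - m + c))) has_sum ?S c) UNIV"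
        by (simp add: sq_gaussian)
    next
      case 2 with has_sum_int2_affine(1)[OF A, where s = "-1" and t = 1 and a = 0 and b = 1]
      show "((\<lambda>(m, n). sg m * sg n * q ^ (sq (2 * m + n + c) + sq (2 * n - m + c))) has_sum ?S c) UNIV"
        by (simp add: sq_gaussian F_def mult.commute[of "sg _" "sg _"])
    next
      case 3 with has_sum_int2_affine(2)[OF A, where s = "-1" and t = "-1" and a = 0 and b = "-1"]
      show "((\<lambda>(m, n). sg m * sg n * q ^ (sq (2 * m + n + c) + sq (2 * n - m + c))) has_sum ?S c) UNIV"
        by (simp add: sq_gaussian F_def mult.commute[of "sg _" "sg _"])
    next
      case 4 with has_sum_int2_affine(2)[OF A, where s = 1 and t = 1 and a = 1 and b = 2]
      show "((\<lambda>(m, n). sg m * sg n * q ^ (sq (2 * m + n + c) + sq (2 * n - m + c))) has_sum ?S c) UNIV"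
        by (simp add: sq_gaussian F_def mult.commute[of "sg _" "sg _"])
    next
      case 5 with has_sum_int2_affine(1)[OF A, where s = 1 and t = "-1" and a = 1 and b = "-2"]
      show "((\<lambda>(m, n). sg m * sg n * q ^ (sq (2 * m + n + c) + sq (2 * n - m + c))) has_sum ?S c) UNIV"
        by (simp add: sq_gaussian F_def mult.commute[of "sg _" "sg _"])
    qed
  qed
  from has_sum_unique[OF this has_sum_product[OF P(1) P(1), unfolded e]]
  show ?thesis by (simp add: power2_eq_square algebra_simps)
qed

text \<open>In the notation used for \<open>tri_gaussian\<close>, \<open>8 wt i j = X\<^sup>2 - Y\<^sup>2\<close>.\<close>

definition wt :: "int \<Rightarrow> int \<Rightarrow> int" where
  "wt i j = 3 * (int (tri i) - int (tri j)) - (2 * i - 1) * (2 * j - 1)"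

text \<open>Completing squares as for \<open>tri_gaussian\<close> evaluates X^2 - Y^2 on each class.
  In classes 2 and 4 the roles of \<open>pent 1\<close> and \<open>pent 3\<close> are exchanged,
  which reverses the sign; class 3 is antisymmetric.\<close>

lemma wt_gaussian:
  "wt (2 * m + n) (2 * n - m) = 5 * (int (pent 1 m) - int (pent 3 n)) - 1"
  "wt (2 * m + n + 1) (2 * n - m + 1) = 5 * (int (pent 1 (- m)) - int (pent 3 (- n))) - 1"
  "wt (2 * m + n + 2) (2 * n - m + 2) = - (5 * (int (pent 1 (1 + n)) - int (pent 3 (- m))) - 1)"
  "wt (2 * m + n + 3) (2 * n - m + 3) = 25 * (int (tri (1 + m)) - int (tri (2 + n)))"
  "wt (2 * m + n + 4) (2 * n - m + 4) = - (5 * (int (pent 1 (- 2 - n)) - int (pent 3 (1 + m))) - 1)"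
proof -
  have T: "A = B" if "2 * A = 2 * B" for A B :: int
    using that by simp
  show "wt (2 * m + n) (2 * n - m) = 5 * (int (pent 1 m) - int (pent 3 n)) - 1"
    using two_tri[of "2 * m + n"] two_tri[of "2 * n - m"] two_pent[of 1 m] two_pent[of 3 n]
    by - (rule T, simp add: wt_def power2_eq_square algebra_simps)
  show "wt (2 * m + n + 1) (2 * n - m + 1) = 5 * (int (pent 1 (- m)) - int (pent 3 (- n))) - 1"
    using two_tri[of "2 * m + n + 1"] two_tri[of "2 * n - m + 1"] two_pent[of 1 "-m"] two_pent[of 3 "-n"]
    by - (rule T, simp add: wt_def power2_eq_square algebra_simps)
  show "wt (2 * m + n + 2) (2 * n - m + 2) = - (5 * (int (pent 1 (1 + n)) - int (pent 3 (- m))) - 1)"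
    using two_tri[of "2 * m + n + 2"] two_tri[of "2 * n - m + 2"] two_pent[of 1 "1+n"] two_pent[of 3 "-m"]
    by - (rule T, simp add: wt_def power2_eq_square algebra_simps)
  show "wt (2 * m + n + 3) (2 * n - m + 3) = 25 * (int (tri (1 + m)) - int (tri (2 + n)))"
    using two_tri[of "2 * m + n + 3"] two_tri[of "2 * n - m + 3"] two_tri[of "1+m"] two_tri[of "2+n"]
    by - (rule T, simp add: wt_def power2_eq_square algebra_simps)
  show "wt (2 * m + n + 4) (2 * n - m + 4) = - (5 * (int (pent 1 (- 2 - n)) - int (pent 3 (1 + m))) - 1)"
    using two_tri[of "2 * m + n + 4"] two_tri[of "2 * n - m + 4"] two_pent[of 1 "-2-n"] two_pent[of 3 "1+m"]
    by - (rule T, simp add: wt_def power2_eq_square algebra_simps)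
qed

lemma has_sum_diff:
  fixes f g :: "'a \<Rightarrow> real"
  assumes "(f has_sum a) A" "(g has_sum b) A"
  shows "((\<lambda>x. f x - g x) has_sum (a - b)) A"
  using has_sum_add[OF assms(1) has_sum_uminusI[OF assms(2)]] by simp

text \<open>The \<open>tri\<close> part of the weight is antisymmetric in the two indices and sums
  to 0, leaving \<open>- X\<^sup>2\<close>. In the splitting, class 3 vanishes for the same reason,
  and the other four classes agree: in classes 2 and 4 the sign reversed in the weight is restored
  by the odd shift in \<open>sg\<close>.\<close>

lemma wronskian_gaussian:
  fixes q :: real
  assumes Z: "((\<lambda>n. sg n * q ^ tri n) has_sum Z) UNIV"
    and T: "((\<lambda>n. sg n * real (tri n) * q ^ tri n) has_sum T) UNIV"
    and Z5: "((\<lambda>n. sg n * (q ^ 5) ^ tri n) has_sum Z5) UNIV"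
    and T5: "((\<lambda>n. sg n * real (tri n) * (q ^ 5) ^ tri n) has_sum T5) UNIV"
    and X: "((\<lambda>n. sg n * of_int (2 * n - 1) * q ^ tri n) has_sum X) UNIV"
    and H: "((\<lambda>n. sg n * q ^ pent 1 n) has_sum H1) UNIV" "((\<lambda>n. sg n * q ^ pent 3 n) has_sum H3) UNIV"
    and H': "((\<lambda>n. sg n * real (pent 1 n) * q ^ pent 1 n) has_sum H1') UNIV"
      "((\<lambda>n. sg n * real (pent 3 n) * q ^ pent 3 n) has_sum H3') UNIV"
  shows "X\<^sup>2 = 4 * (H1 * H3 + 5 * (H1 * H3' - H1' * H3))"
proof -
  define F where "F m n = sg m * sg n * of_int (5 * (int (pent 1 m) - int (pent 3 n)) - 1)
    * q ^ (pent 1 m + pent 3 n)" for m n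
  define K where "K m n = - (sg m * sg n * of_int (25 * (int (tri m) - int (tri n))) * q ^ (1 + 5 * (tri m + tri n)))"
    for m n
  let ?h = "5 * (H1' * H3 - H1 * H3') - H1 * H3"
  let ?S = "\<lambda>c::int. if c = 3 then 0 else ?h"
  have neg: "- (a * (5 * x - 5 * y - 1) * b) = a * (1 - (5 * x - 5 * y)) * b" for a b x y :: real
    by (simp add: algebra_simps)
  have A: "((\<lambda>(m, n). F m n) has_sum ?h) UNIV"
    using has_sum_diff[OF has_sum_cmult_right[OF has_sum_diff[OF has_sum_product[OF H'(1) H(2)]
          has_sum_product[OF H(1) H'(2)]], of 5] has_sum_product[OF H]]
    unfolding F_def by (simp add: case_prod_unfold algebra_simps power_add)
  have e5: "(q ^ 5) ^ x = (q ^ x) ^ 5" for x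
    by (simp add: power_mult[symmetric] mult.commute)
  have B: "((\<lambda>(m, n). K m n) has_sum 0) UNIV"
    using has_sum_uminusI[OF has_sum_cmult_right[OF has_sum_diff[OF has_sum_product[OF T5 Z5]
          has_sum_product[OF Z5 T5]], of "25 * q"]]
    unfolding K_def e5 by (simp add: case_prod_unfold algebra_simps power_add power_mult)
  have C: "((\<lambda>(i, j). sg i * sg j * of_int (wt i j) * q ^ (tri i + tri j)) has_sum (- X\<^sup>2)) UNIV"
    using has_sum_diff[OF has_sum_cmult_right[OF has_sum_diff[OF has_sum_product[OF T Z]
          has_sum_product[OF Z T]], of 3] has_sum_product[OF X X]]
    unfolding wt_def by (simp add: case_prod_unfold algebra_simps power_add power2_eq_square)
  have "((\<lambda>(i, j). sg i * sg j * of_int (wt i j) * q ^ (tri i + tri j)) has_sum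
      (?S 0 + ?S 1 + ?S 2 + ?S 3 + ?S 4)) UNIV"
  proof (rule has_sum_gaussian_split)
    fix c :: int assume "c \<in> {0, 1, 2, 3, 4}"
    then consider "c = 0" | "c = 1" | "c = 2" | "c = 3" | "c = 4" by auto
    then have "((\<lambda>(m, n). sg m * sg n * of_int (wt (2 * m + n + c) (2 * n - m + c)) *
        q ^ (tri (2 * m + n + c) + tri (2 * n - m + c))) has_sum ?S c) UNIV" (is ?goal)
    proof cases
      case 1 with A show ?goal
        by (simp add: tri_gaussian wt_gaussian F_def)
    next
      case 2 with has_sum_int2_affine(1)[OF A, where s = "-1" and t = "-1" and a = 0 and b = 0]
      show ?goal by (simp add: tri_gaussian wt_gaussian F_def)
    next
      case 3 with has_sum_int2_affine(2)[OF A, where s = "-1" and t = 1 and a = 0 and b = 1]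
      show ?goal by (simp add: tri_gaussian wt_gaussian F_def neg mult.commute[of "sg _" "sg _"])
    next
      case 4 with has_sum_int2_affine(1)[OF B, where s = 1 and t = 1 and a = 1 and b = 2]
      show ?goal by (simp add: tri_gaussian wt_gaussian K_def)
    next
      case 5 with has_sum_int2_affine(2)[OF A, where s = 1 and t = "-1" and a = 1 and b = "-2"]
      show ?goal by (simp add: tri_gaussian wt_gaussian F_def neg mult.commute[of "sg _" "sg _"])
    qed
    then show "((\<lambda>(m, n). sg (2 * m + n + c) * sg (2 * n - m + c) * of_int (wt (2 * m + n + c) (2 * n - m + c)) *
        q ^ (tri (2 * m + n + c) + tri (2 * n - m + c))) has_sum ?S c) UNIV"
      unfolding sg_gaussian .
  qed
  from has_sum_unique[OF this C] show ?thesis by (simp add: algebra_simps)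
qed

text \<open>Injectivity of \<open>E\<close> turns the series into a power series with coefficients
  bounded by 1, which may be differentiated term by term inside the unit interval.\<close>

lemma has_sum_theta_deriv:
  fixes E :: "int \<Rightarrow> nat" and s :: "int \<Rightarrow> real" and F :: "real \<Rightarrow> real"
  assumes inj: "inj E" and s: "\<And>n. \<bar>s n\<bar> \<le> 1"
    and F: "\<And>x. 0 < x \<Longrightarrow> x < 1 \<Longrightarrow> ((\<lambda>n. s n * x ^ E n) has_sum F x) UNIV"
    and q: "0 < q" "q < 1"
  obtains D where "(F has_real_derivative D) (at q)"
    "((\<lambda>n. s n * real (E n) * q ^ E n) has_sum q * D) UNIV"
proof -
  define c where "c k = (if k \<in> range E then s (inv E k) else 0)" for k
  have c_E: "c (E n) = s n" for n
    using inj by (simp add: c_def)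
  have c1: "\<bar>c k\<bar> \<le> 1" for k
    using s by (simp add: c_def)
  have transfer: "((\<lambda>k. c k * h k) has_sum S) UNIV \<longleftrightarrow> ((\<lambda>n. s n * h (E n)) has_sum S) UNIV"
    for h :: "nat \<Rightarrow> real" and S
  proof -
    have "((\<lambda>k. c k * h k) has_sum S) UNIV \<longleftrightarrow> ((\<lambda>k. c k * h k) has_sum S) (range E)"
      by (rule has_sum_cong_neutral) (auto simp: c_def)
    also have "\<dots> \<longleftrightarrow> ((\<lambda>n. s n * h (E n)) has_sum S) UNIV"
      by (subst has_sum_reindex[OF inj]) (simp add: o_def c_E)
    finally show ?thesis .
  qed
  have smb: "summable (\<lambda>n. d n * x ^ n)" if "\<And>k. \<bar>d k\<bar> \<le> 1" "norm x < 1" for d :: "nat \<Rightarrow> real" and x :: real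
  proof (rule summable_comparison_test')
    show "summable (\<lambda>n. \<bar>x\<bar> ^ n)" using that(2) by (intro summable_geometric) simp
    show "norm (d n * x ^ n) \<le> \<bar>x\<bar> ^ n" for n
      using mult_right_mono[OF that(1)[of n], of "\<bar>x\<bar> ^ n"] by (simp add: abs_mult power_abs)
  qed
  \<comment> \<open>Stated for any bounded \<open>d\<close>: it is applied to \<open>c\<close> for
    the value and to the absolute values of \<open>c\<close> for absolute summability.\<close>
  have dif: "(\<lambda>n. d n * (real n * q ^ n)) sums (q * (\<Sum>n. diffs d n * q ^ n))" if "\<And>k. \<bar>d k\<bar> \<le> 1" for d
  proof -
    have "summable (\<lambda>n. diffs d n * q ^ n)"
      using termdiff_converges[of q 1 d] smb[OF that] q by simp
    from sums_mult[OF diffs_equiv[OF this], of q]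
    have "(\<lambda>n. q * (real n * d n * q ^ (n - 1))) sums (q * (\<Sum>n. diffs d n * q ^ n))" by simp
    also have "(\<lambda>n. q * (real n * d n * q ^ (n - 1))) = (\<lambda>n. d n * (real n * q ^ n))"
    proof
      fix n show "q * (real n * d n * q ^ (n - 1)) = d n * (real n * q ^ n)"
        by (cases n) auto
    qed
    finally show ?thesis .
  qed
  define D where "D = (\<Sum>n. diffs c n * q ^ n)"
  have "((\<lambda>x. \<Sum>n. c n * x ^ n) has_real_derivative D) (at q)"
    unfolding D_def by (rule termdiffs_strong'[of 1]) (use smb[OF c1] q in auto)
  then have "(F has_real_derivative D) (at q)"
  proof (rule has_field_derivative_transform_within_open[of _ _ _ "{0<..<1}"])
    fix x :: real assume "x \<in> {0<..<1}"
    then have "((\<lambda>n. c n * x ^ n) has_sum F x) UNIV"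
      using F[of x] unfolding transfer by simp
    then show "(\<Sum>n. c n * x ^ n) = F x"
      using has_sum_imp_sums sums_unique by metis
  qed (use q in auto)
  moreover have "((\<lambda>n. c n * (real n * q ^ n)) has_sum q * D) UNIV"
  proof (rule norm_summable_imp_has_sum)
    show "(\<lambda>n. c n * (real n * q ^ n)) sums (q * D)"
      unfolding D_def by (rule dif[OF c1])
    have "summable (\<lambda>n. \<bar>c n\<bar> * (real n * q ^ n))"
      by (rule sums_summable[OF dif]) (use c1 in auto)
    then show "summable (\<lambda>n. norm (c n * (real n * q ^ n)))"
      using q by (simp add: abs_mult)
  qed
  then have "((\<lambda>n. s n * real (E n) * q ^ E n) has_sum q * D) UNIV"
    unfolding transfer by (simp add: mult.assoc)
  ultimately show ?thesis by (rule that)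
qed

text \<open>As \<open>tri\<close> is not injective, \<open>has_sum_theta_deriv\<close> does not
  apply. Writing \<open>q = r * r\<close>, one power of \<open>r\<close> bounds the factor
  \<open>tri n\<close> and the other gives a summable theta series.\<close>

lemma summable_on_tri_times:
  fixes q :: real
  assumes q: "0 < q" "q < 1"
  shows "(\<lambda>n. sg n * real (tri n) * q ^ tri n) summable_on UNIV"
proof -
  define r where "r = sqrt q"
  have r: "0 < r" "r < 1" "r * r = q" using q by (auto simp: r_def)
  have "Bseq (\<lambda>k. real k * r ^ k)"
    using powser_times_n_limit_0[of r] r by (intro convergent_imp_Bseq convergentI) auto
  then obtain C where C: "\<And>k. norm (real k * r ^ k) \<le> C"
    by (auto simp: Bseq_def)
  show ?thesis
  proof (rule abs_summable_summable, rule summable_on_comparison_test)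
    show "(\<lambda>n. C * \<bar>r ^ tri n * 1 powi n\<bar>) summable_on UNIV"
      by (intro summable_on_cmult_right summable_on_theta r) auto
    fix n
    have "norm (sg n * real (tri n) * q ^ tri n) = norm (real (tri n) * r ^ tri n) * r ^ tri n"
      using r by (simp add: r(3)[symmetric] sg_def power_mult_distrib abs_mult)
    also have "\<dots> \<le> C * r ^ tri n"
      using C[of "tri n"] r by (intro mult_right_mono) auto
    finally show "norm (sg n * real (tri n) * q ^ tri n) \<le> C * \<bar>r ^ tri n * 1 powi n\<bar>"
      using r by simp
  qed auto
qed

section \<open>Product forms and the modular equation\<close>

lemma f_neg_qpoch: "f_neg q = qpoch q q"
  by (simp add: f_neg_def qpoch_def)

lemma f_neg_pos:
  assumes "0 < q" "q < 1"
  shows "f_neg q > 0"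
  using qfac_bounds(3)[OF assms] by (simp add: f_neg_qpoch)

lemma qpoch_shift:
  assumes "\<bar>q\<bar> < 1"
  shows "qpoch a q = (1 - a) * qpoch (a * q) q"
proof -
  have "(\<lambda>n. (1 - a) * (\<Prod>k<n. 1 - a * q * q ^ k)) \<longlonglongrightarrow> (1 - a) * qpoch (a * q) q"
    by (intro tendsto_mult_left qpoch_tendsto assms)
  also have "(\<lambda>n. (1 - a) * (\<Prod>k<n. 1 - a * q * q ^ k)) = (\<lambda>n. \<Prod>k<Suc n. 1 - a * q ^ k)"
    by (subst prod.lessThan_Suc_shift) (simp add: mult.assoc)
  finally show ?thesis
    using LIMSEQ_unique[OF LIMSEQ_Suc[OF qpoch_tendsto[OF assms]]] by blast
qed

lemma qpoch_minus_self:
  assumes q: "0 < q" "q < 1"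
  shows "qpoch (- q) q = f_neg (q\<^sup>2) / f_neg q"
  using qpoch_mult_minus[of q q] f_neg_pos[OF q] q by (simp add: f_neg_qpoch field_simps)

text \<open>The sum over all integers is 2 psi(q), the 2 being the first factor of
  \<open>qpoch (- 1) q\<close>. With signs the product contains
  \<open>qpoch 1 q = 0\<close>.\<close>

lemma has_sum_psi:
  assumes q: "0 < q" "q < 1"
  shows "((\<lambda>n. q ^ tri n) has_sum 2 * f_neg (q\<^sup>2) ^ 2 / f_neg q) UNIV"
    and "((\<lambda>n. sg n * q ^ tri n) has_sum 0) UNIV"
proof -
  have E: "2 * int (tri n) = int 1 * (n * (n - 1)) + 2 * int 0 * n" for n
    by (simp add: two_tri)
  have "qpoch (- 1) q = 2 * qpoch (- q) q"
    using qpoch_shift[of q "-1"] q by simp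
  then show "((\<lambda>n. q ^ tri n) has_sum 2 * f_neg (q\<^sup>2) ^ 2 / f_neg q) UNIV"
    using has_sum_theta[OF q, of 1 0 1 tri] E q f_neg_pos[OF q]
    by (simp add: qpoch_minus_self f_neg_qpoch[symmetric] power2_eq_square mult.assoc)
  have "qpoch 1 q = 0"
    using qpoch_shift[of q 1] q by simp
  then show "((\<lambda>n. sg n * q ^ tri n) has_sum 0) UNIV"
    using has_sum_theta[OF q, of "-1" 0 1 tri] E q by (simp add: minus_one_powi)
qed

lemma has_sum_phi:
  assumes q: "0 < q" "q < 1"
  shows "((\<lambda>n. sg n * q ^ sq n) has_sum f_neg q ^ 2 / f_neg (q\<^sup>2)) UNIV"
proof -
  have E: "2 * int (sq n) = int 2 * (n * (n - 1)) + 2 * int 1 * n" for n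
    by (simp add: int_sq algebra_simps power2_eq_square)
  have q2: "0 < q\<^sup>2" "q\<^sup>2 < 1" using q by (auto simp: power_less_one_iff)
  have "f_neg q = qpoch q (q\<^sup>2) * f_neg (q\<^sup>2)"
    using qpoch_dissect[of q 2 q] q by (simp add: f_neg_qpoch numeral_2_eq_2)
  then have "qpoch q (q\<^sup>2) = f_neg q / f_neg (q\<^sup>2)"
    using f_neg_pos[OF q2] by simp
  then show ?thesis
    using has_sum_theta[OF q, of "-1" 1 2 sq] E f_neg_pos[OF q2]
    by (simp add: minus_one_powi f_neg_qpoch[symmetric] power2_eq_square)
qed

text \<open>The case \<open>s = 1\<close> enters the identity for psi, the case
  \<open>s = -1\<close> the continued fraction.\<close>

lemma has_sum_pent:
  fixes q s :: real
  assumes q: "0 < q" "q < 1" and s: "s = 1 \<or> s = -1"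
  shows "((\<lambda>n. s powi n * q ^ pent 1 n) has_sum
      f_neg (q ^ 5) * qpoch (- s * q ^ 2) (q ^ 5) * qpoch (- s * q ^ 3) (q ^ 5)) UNIV"
    and "((\<lambda>n. s powi n * q ^ pent 3 n) has_sum
      f_neg (q ^ 5) * qpoch (- s * q) (q ^ 5) * qpoch (- s * q ^ 4) (q ^ 5)) UNIV"
  using has_sum_theta[OF q s, of 2 5 "pent 1"] has_sum_theta[OF q s, of 1 5 "pent 3"]
  by (simp_all add: two_pent f_neg_qpoch algebra_simps power2_eq_square)

section \<open>Product forms of the psi and phi identities\<close>

lemma qpoch_five:
  assumes "0 < q" "q < 1"
  shows "qpoch (s * q) q = qpoch (s * q) (q ^ 5) * qpoch (s * q ^ 2) (q ^ 5)
    * qpoch (s * q ^ 3) (q ^ 5) * qpoch (s * q ^ 4) (q ^ 5) * qpoch (s * q ^ 5) (q ^ 5)"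
  using qpoch_dissect[of q 5 "s * q"] assms
  by (simp add: eval_nat_numeral mult.assoc)

lemma psi_identity:
  assumes q: "0 < q" "q < 1"
  shows "f_neg (q^2) ^ 4 * f_neg (q^5) ^ 2 * f_neg (q^10) - q * f_neg q ^ 2 * f_neg (q^10) ^ 5
    = f_neg q * f_neg (q^2) * f_neg (q^5) ^ 5"
proof -
  have q5: "0 < q ^ 5" "q ^ 5 < 1" and q10: "0 < q ^ 10" "q ^ 10 < 1" using q by (auto simp: power_less_one_iff)
  define a b c d where "a = f_neg q" and "b = f_neg (q^2)" and "c = f_neg (q^5)" and "d = f_neg (q^10)"
  note defs = a_def b_def c_def d_def
  have nz: "a > 0" "c > 0" "d > 0"
    unfolding defs using f_neg_pos[OF q] f_neg_pos[OF q5] f_neg_pos[OF q10] by auto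
  have e: "(q ^ 5)\<^sup>2 = q ^ 10" by (simp add: power_mult[symmetric])
  define H1 where "H1 = c * qpoch (- (q ^ 2)) (q ^ 5) * qpoch (- (q ^ 3)) (q ^ 5)"
  define H3 where "H3 = c * qpoch (- q) (q ^ 5) * qpoch (- (q ^ 4)) (q ^ 5)"
  have "((\<lambda>n. q ^ tri n) has_sum (2 * b\<^sup>2 / a)) UNIV" "((\<lambda>n. (q ^ 5) ^ tri n) has_sum (2 * d\<^sup>2 / c)) UNIV"
    using has_sum_psi(1)[OF q] has_sum_psi(1)[OF q5] by (simp_all add: e defs)
  moreover have "((\<lambda>n. q ^ pent 1 n) has_sum H1) UNIV" "((\<lambda>n. q ^ pent 3 n) has_sum H3) UNIV"
    using has_sum_pent[OF q, of 1] by (simp_all add: H1_def H3_def c_def)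
  ultimately have "(2 * b\<^sup>2 / a)\<^sup>2 - q * (2 * d\<^sup>2 / c)\<^sup>2 = 4 * H1 * H3"
    by (rule psi_gaussian)
  \<comment> \<open>\<open>H1\<close> and \<open>H3\<close> together hold the nonzero residues
    modulo 5 in the product for \<open>qpoch (- q) q\<close>; the residue 0 supplies
    \<open>d / c\<close>.\<close>
  moreover have "H1 * H3 * (d / c) = c\<^sup>2 * (b / a)"
    using qpoch_five[OF q, of "-1"] qpoch_minus_self[OF q] qpoch_minus_self[OF q5]
    unfolding e defs[symmetric] H1_def H3_def by (simp add: power2_eq_square mult_ac)
  then have "H1 * H3 * (a * d) = b * c ^ 3"
    using nz by (simp add: field_simps power2_eq_square power3_eq_cube)
  moreover have "2 * b\<^sup>2 / a * a = 2 * b\<^sup>2" "2 * d\<^sup>2 / c * c = 2 * d\<^sup>2"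
    using nz by simp_all
  ultimately have "b ^ 4 * c ^ 2 * d - q * a ^ 2 * d ^ 5 = a * b * c ^ 5"
    by algebra
  then show ?thesis by (simp add: defs)
qed

lemma phi_identity:
  assumes q: "0 < q" "q < 1"
  shows "f_neg (q^2) ^ 2 * f_neg (q^5) ^ 5 - f_neg q ^ 4 * f_neg (q^5) * f_neg (q^10) ^ 2
    = 4 * q * f_neg q * f_neg (q^2) * f_neg (q^10) ^ 5"
proof -
  have q5: "0 < q ^ 5" "q ^ 5 < 1" and q10: "0 < q ^ 10" "q ^ 10 < 1" and q2: "0 < q ^ 2" "q ^ 2 < 1"
    using q by (auto simp: power_less_one_iff)
  define a b c d where "a = f_neg q" and "b = f_neg (q^2)" and "c = f_neg (q^5)" and "d = f_neg (q^10)"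
  note defs = a_def b_def c_def d_def
  have nz: "a > 0" "b > 0" "c > 0" "d > 0"
    unfolding defs using f_neg_pos[OF q] f_neg_pos[OF q2] f_neg_pos[OF q5] f_neg_pos[OF q10] by auto
  have e: "(q ^ 5)\<^sup>2 = q ^ 10" "(q\<^sup>2) ^ 5 = q ^ 10" by (simp_all add: power_mult[symmetric])
  define G2 where "G2 = d * qpoch (q ^ 3) (q ^ 10) * qpoch (q ^ 7) (q ^ 10)"
  define G4 where "G4 = d * qpoch q (q ^ 10) * qpoch (q ^ 9) (q ^ 10)"
  have P: "((\<lambda>n. sg n * q ^ sq n) has_sum (a\<^sup>2 / b)) UNIV" "((\<lambda>n. sg n * (q ^ 5) ^ sq n) has_sum (c\<^sup>2 / d)) UNIV"
    using has_sum_phi[OF q] has_sum_phi[OF q5] by (simp_all add: e defs)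
  have G: "((\<lambda>n. sg n * q ^ dec 2 n) has_sum G2) UNIV" "((\<lambda>n. sg n * q ^ dec 4 n) has_sum G4) UNIV"
    using has_sum_theta[OF q, of "-1" 3 10 "dec 2"] has_sum_theta[OF q, of "-1" 1 10 "dec 4"]
    by (simp_all add: minus_one_powi G2_def G4_def int_dec d_def f_neg_qpoch algebra_simps power2_eq_square)
  have odd: "qpoch r (r\<^sup>2) = f_neg r / f_neg (r\<^sup>2)" if r: "0 < r" "r < 1" for r
  proof -
    have "0 < r\<^sup>2" "r\<^sup>2 < 1" using r by (auto simp: power_less_one_iff)
    then show ?thesis
      using qpoch_dissect[of r 2 r] r f_neg_pos[of "r\<^sup>2"] by (simp add: f_neg_qpoch numeral_2_eq_2)
  qed
  have "qpoch q (q\<^sup>2) = qpoch q (q ^ 10) * qpoch (q ^ 3) (q ^ 10) * qpoch (q ^ 5) (q ^ 10)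
     * qpoch (q ^ 7) (q ^ 10) * qpoch (q ^ 9) (q ^ 10)"
    using qpoch_dissect[of "q\<^sup>2" 5 q] q2 unfolding e by (simp add: eval_nat_numeral mult.assoc)
  moreover have "qpoch q (q\<^sup>2) = a / b" "qpoch (q ^ 5) (q ^ 10) = c / d"
    using odd[OF q] odd[OF q5] by (simp_all add: e defs)
  \<comment> \<open>\<open>G2\<close> and \<open>G4\<close> hold the residues 1, 3, 7, 9 modulo 10;
    the remaining odd residue 5 supplies \<open>c / d\<close>.\<close>
  ultimately have "G2 * G4 * (c / d) = d\<^sup>2 * (a / b)"
    unfolding G2_def G4_def by (simp add: power2_eq_square mult_ac)
  then have "G2 * G4 = a * d ^ 3 / (b * c)"
    using nz by (simp add: field_simps power2_eq_square power3_eq_cube)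
  with phi_gaussian[OF P G] have "(c\<^sup>2 / d)\<^sup>2 - (a\<^sup>2 / b)\<^sup>2 = 4 * q * (a * d ^ 3 / (b * c))"
    by simp
  moreover have "c\<^sup>2 / d * d = c\<^sup>2" "a\<^sup>2 / b * b = a\<^sup>2" "a * d ^ 3 / (b * c) * (b * c) = a * d ^ 3"
    using nz by simp_all
  ultimately have "b ^ 2 * c ^ 5 - a ^ 4 * c * d ^ 2 = 4 * q * a * b * d ^ 5"
    by algebra
  then show ?thesis by (simp add: defs)
qed

lemma degree_five_relation:
  fixes a b c d q :: real
  assumes nz: "a > 0" "b > 0" "c > 0" "d > 0" "q > 0"
    and 1: "b ^ 4 * c ^ 2 * d - q * a ^ 2 * d ^ 5 = a * b * c ^ 5"
    and 2: "b ^ 2 * c ^ 5 - a ^ 4 * c * d ^ 2 = 4 * q * a * b * d ^ 5"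
  shows "q * a ^ 6 * d ^ 6 + b ^ 6 * c ^ 6 - 5 * q * a^2 * b^2 * c^4 * d^4 - a^4 * b^4 * c^2 * d^2 = 0"
proof -
  \<comment> \<open>The first factor is the right-hand side of \<open>2\<close>; being positive, it
    can be divided out.\<close>
  have "(4 * q * a * b * d ^ 5) * (b ^ 5 * c ^ 2 - 5 * q * a ^ 2 * b * d ^ 4 - a ^ 5 * c * d) = 0"
    using 1 2 by algebra
  then have 3: "b ^ 5 * c ^ 2 - 5 * q * a ^ 2 * b * d ^ 4 = a ^ 5 * c * d"
    using nz by simp
  \<comment> \<open>\<open>1\<close> times \<open>a ^ 4 * d\<close> and \<open>3\<close> times
    \<open>b * c ^ 4\<close> have the same right-hand side; their difference is the claim.\<close>
  show ?thesis using 1 3 by algebra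
qed

section \<open>The derivative of the continued fraction\<close>

lemma rr_cf_eq:
  assumes x: "0 < x" "x < 1"
  shows "rr_cf x = x powr (1/5) *
    ((f_neg (x ^ 5) * qpoch x (x ^ 5) * qpoch (x ^ 4) (x ^ 5)) /
     (f_neg (x ^ 5) * qpoch (x ^ 2) (x ^ 5) * qpoch (x ^ 3) (x ^ 5)))"
proof -
  have x5: "0 < x ^ 5" "x ^ 5 < 1" using x by (auto simp: power_less_one_iff)
  have cv: "convergent_prod (\<lambda>n. 1 - x ^ i * (x ^ 5) ^ n)" for i
    using x5 by (intro qpoch_convergent) auto
  have e: "x ^ (5 * n + i) = x ^ i * (x ^ 5) ^ n" for n i
    by (simp add: power_add power_mult)
  have "(\<Prod>n. ((1 - x ^ (5*n+1)) * (1 - x ^ (5*n+4))) / ((1 - x ^ (5*n+2)) * (1 - x ^ (5*n+3))))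
     = (qpoch (x ^ 1) (x ^ 5) * qpoch (x ^ 4) (x ^ 5)) / (qpoch (x ^ 2) (x ^ 5) * qpoch (x ^ 3) (x ^ 5))"
    unfolding e qpoch_def
    by (subst prodinf_divide[symmetric] prodinf_mult[symmetric]; (intro convergent_prod_mult cv)?)+ simp
  \<comment> \<open>Numerator and denominator are both multiplied by \<open>f_neg (x ^ 5)\<close>,
    which makes each a full theta function.\<close>
  then show ?thesis
    using f_neg_pos[OF x5] by (simp add: rr_cf_def mult.assoc)
qed

text \<open>The part with weight \<open>n\<close> is Jacobi's cube, and the constant part vanishes
  by \<open>has_sum_psi\<close>.\<close>

lemma has_sum_odd_weight:
  assumes q: "0 < q" "q < 1"
  shows "((\<lambda>n. sg n * of_int (2 * n - 1) * q ^ tri n) has_sum (- 2 * f_neg q ^ 3)) UNIV"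
proof -
  have "q ^ tri n * (of_int n * (-1) powi (n - 1)) = - (sg n * of_int n * q ^ tri n)" for n
    by (simp add: minus_one_powi sg_def)
  then have "((\<lambda>n. - (sg n * of_int n * q ^ tri n)) has_sum f_neg q ^ 3) UNIV"
    using jacobi_cube[OF q] by (simp add: f_neg_qpoch)
  from has_sum_diff[OF has_sum_cmult_right[OF this, of "-2"] has_sum_psi(2)[OF q]]
  show ?thesis by (simp add: algebra_simps)
qed

text \<open>The logarithmic derivative of q^(1/5) H3/H1 is (H1 H3 + 5q(H1 H3' - H1' H3)) / (5q H1
  H3). By \<open>wronskian_gaussian\<close> the numerator is the sixth power of
  \<open>f_neg q\<close>.\<close>

lemma deriv_rr_cf:
  assumes q: "0 < q" "q < 1"
  shows "deriv rr_cf q / rr_cf q = f_neg q ^ 5 / (5 * q * f_neg (q ^ 5))"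
proof -
  have q5: "0 < q ^ 5" "q ^ 5 < 1" using q by (auto simp: power_less_one_iff)
  define H1 where "H1 x = f_neg (x ^ 5) * qpoch (x ^ 2) (x ^ 5) * qpoch (x ^ 3) (x ^ 5)" for x
  define H3 where "H3 x = f_neg (x ^ 5) * qpoch x (x ^ 5) * qpoch (x ^ 4) (x ^ 5)" for x
  have sum1: "((\<lambda>n. sg n * x ^ pent 1 n) has_sum H1 x) UNIV"
    and sum3: "((\<lambda>n. sg n * x ^ pent 3 n) has_sum H3 x) UNIV" if "0 < x" "x < 1" for x
    using has_sum_pent[OF that, of "-1"] by (simp_all add: minus_one_powi H1_def H3_def)
  have sg1: "\<bar>sg n\<bar> \<le> 1" for n by (simp add: sg_def)
  obtain D1 where D1: "(H1 has_real_derivative D1) (at q)"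
    "((\<lambda>n. sg n * real (pent 1 n) * q ^ pent 1 n) has_sum q * D1) UNIV"
    using has_sum_theta_deriv[OF inj_pent[of 1] sg1 sum1 q] by auto
  obtain D3 where D3: "(H3 has_real_derivative D3) (at q)"
    "((\<lambda>n. sg n * real (pent 3 n) * q ^ pent 3 n) has_sum q * D3) UNIV"
    using has_sum_theta_deriv[OF inj_pent[of 3] sg1 sum3 q] by auto
  define a c where "a = f_neg q" and "c = f_neg (q ^ 5)"
  have pos: "a > 0" "c > 0" using f_neg_pos[OF q] f_neg_pos[OF q5] by (auto simp: a_def c_def)
  \<comment> \<open>Together the two theta functions contain all residues modulo 5, the residue 0
    twice.\<close>
  have prod: "H1 q * H3 q = a * c"
    using qpoch_five[OF q, of 1] by (simp add: H1_def H3_def a_def c_def f_neg_qpoch mult_ac)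
  then have nz: "H1 q \<noteq> 0" "H3 q \<noteq> 0" using pos by auto
  have "(- 2 * a ^ 3)\<^sup>2 = 4 * (H1 q * H3 q + 5 * (H1 q * (q * D3) - q * D1 * H3 q))"
    unfolding a_def
    by (rule wronskian_gaussian[OF has_sum_psi(2)[OF q] has_sum_infsum[OF summable_on_tri_times[OF q]]
          has_sum_psi(2)[OF q5] has_sum_infsum[OF summable_on_tri_times[OF q5]]
          has_sum_odd_weight[OF q] sum1[OF q] sum3[OF q] D1(2) D3(2)])
  then have W: "a ^ 6 = H1 q * H3 q + 5 * q * (H1 q * D3 - D1 * H3 q)"
    by (simp add: power_mult_distrib power_mult[symmetric] algebra_simps)
  have "((\<lambda>x. x powr (1/5) * (H3 x / H1 x)) has_real_derivative
      (1/5) * q powr (1/5 - 1) * (H3 q / H1 q) + (D3 * H1 q - H3 q * D1) / (H1 q * H1 q) * q powr (1/5)) (at q)"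
  proof (rule DERIV_mult[OF _ DERIV_divide[OF D3(1) D1(1) nz(1)]])
    show "((\<lambda>x. x powr (1/5)) has_real_derivative (1/5) * q powr (1/5 - 1)) (at q)"
      using q by (auto intro!: derivative_eq_intros)
  qed
  then have "(rr_cf has_real_derivative
      (1/5) * q powr (1/5 - 1) * (H3 q / H1 q) + (D3 * H1 q - H3 q * D1) / (H1 q * H1 q) * q powr (1/5)) (at q)"
    by (rule has_field_derivative_transform_within_open[of _ _ _ "{0<..<1}"])
      (use q in \<open>auto simp: rr_cf_eq H1_def H3_def\<close>)
  then have d: "deriv rr_cf q =
      (1/5) * q powr (1/5 - 1) * (H3 q / H1 q) + (D3 * H1 q - H3 q * D1) / (H1 q * H1 q) * q powr (1/5)"
    by (rule DERIV_imp_deriv)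
  have r: "rr_cf q = q powr (1/5) * (H3 q / H1 q)"
    using rr_cf_eq[OF q] by (simp add: H1_def H3_def)
  have p: "q powr (1/5 - 1) = q powr (1/5) / q"
    using powr_diff[of q "1/5" 1] q by simp
  have "deriv rr_cf q / rr_cf q = (H1 q * H3 q + 5 * q * (H1 q * D3 - D1 * H3 q)) / (5 * q * (H1 q * H3 q))"
    unfolding d r p using q nz by (simp add: field_simps)
  also have "\<dots> = a ^ 5 / (5 * q * c)"
    unfolding W[symmetric] unfolding prod using pos q by (simp add: field_simps eval_nat_numeral)
  finally show ?thesis by (simp add: a_def c_def)
qed

lemma rr_N_eq:
  assumes q: "0 < q" "q < 1"
  shows "rr_N q = q powr (- 1/6) * f_neg q / (5 * f_neg (q ^ 5))"
proof -
  have "q powr (5/6) = q powr (- 1/6) * q"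
    using powr_add[of q "- 1/6" 1] q by simp
  then show ?thesis
    using q f_neg_pos[OF q] unfolding rr_N_def deriv_rr_cf[OF q]
    by (simp add: power_int_minus field_simps eval_nat_numeral)
qed

theorem mainTheorem2:
  fixes q u v :: real
  assumes "0 < q" and "q < 1"
    and "u = rr_N q" and "v = rr_N (q^2)"
  shows "5 * u^6 - u^2 * v^2 - 125 * u^4 * v^4 + 5 * v^6 = 0"
proof -
  note q = assms(1,2)
  have q2: "0 < q\<^sup>2" "q\<^sup>2 < 1" and q5: "0 < q ^ 5" "q ^ 5 < 1" and q10: "0 < q ^ 10" "q ^ 10 < 1"
    using q by (auto simp: power_less_one_iff)
  define a b c d where "a = f_neg q" and "b = f_neg (q^2)" and "c = f_neg (q^5)" and "d = f_neg (q^10)"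
  note defs = a_def b_def c_def d_def
  have pos: "a > 0" "b > 0" "c > 0" "d > 0"
    unfolding defs using f_neg_pos[OF q] f_neg_pos[OF q2] f_neg_pos[OF q5] f_neg_pos[OF q10] by auto
  define t where "t = q powr (- 1/6)"
  have t: "t > 0" using q by (simp add: t_def)
  have "t ^ 6 = t powr 6" using t by simp
  also have "\<dots> = q powr (- 1)" unfolding t_def powr_powr by simp
  finally have t6: "t ^ 6 * q = 1"
    using q by (simp add: powr_minus)
  have u: "u = t * a / (5 * c)"
    using rr_N_eq[OF q] assms(3) by (simp add: t_def defs)
  have "(q powr 2) powr (- 1/6) = t powr 2"
    unfolding t_def powr_powr by simp
  then have "(q\<^sup>2) powr (- 1/6) = t\<^sup>2"
    using q t by simp
  moreover have "(q\<^sup>2) ^ 5 = q ^ 10" by (simp add: power_mult[symmetric])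
  ultimately have v: "v = t\<^sup>2 * b / (5 * d)"
    using rr_N_eq[OF q2] assms(4) by (simp add: defs)
  have rel: "q * a ^ 6 * d ^ 6 + b ^ 6 * c ^ 6 - 5 * q * a^2 * b^2 * c^4 * d^4 - a^4 * b^4 * c^2 * d^2 = 0"
    using degree_five_relation[OF pos q(1)] psi_identity[OF q] phi_identity[OF q] unfolding defs by simp
  \<comment> \<open>Since 3125 = 5^5, this factor clears all denominators of
    \<open>5 * u c = t a\<close> and \<open>5 * v d = t\<^sup>2 b\<close> in every term.\<close>
  have "3125 * c ^ 6 * d ^ 6 * (5 * u^6 - u^2 * v^2 - 125 * u^4 * v^4 + 5 * v^6)
    = t ^ 6 * a ^ 6 * d ^ 6 + t ^ 12 * b ^ 6 * c ^ 6 - 5 * t ^ 6 * a^2 * b^2 * c^4 * d^4 - t ^ 12 * a^4 * b^4 * c^2 * d^2"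
  proof -
    have uc: "5 * u * c = t * a" and vd: "5 * v * d = t\<^sup>2 * b"
      using u v pos by simp_all
    show ?thesis using uc vd by algebra
  qed
  \<comment> \<open>Replacing \<open>t ^ 6\<close> by \<open>t ^ 12 * q\<close> gives all terms the
    same power of \<open>t\<close>.\<close>
  also have "\<dots> = t ^ 12 * (q * a ^ 6 * d ^ 6 + b ^ 6 * c ^ 6 - 5 * q * a^2 * b^2 * c^4 * d^4 - a^4 * b^4 * c^2 * d^2)"
    using t6 by algebra
  also have "\<dots> = 0" using rel by simp
  finally show ?thesis using pos by simp
qed

end
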